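(* Let $A(n)$ be an arbitrary formula of $\mathrm{HA}^\omega$ and let $R$ be a $\Sigma^0_1$-formula. Then, provably in $\mathrm{HA}^\omega+\mathrm{BI}+\mathrm{CONT}$ together with the defining equation of $\mathsf{ips}$, the functional $\mathsf{ips}_0$ modified realizes the $J$-shift $$\forall n^{\mathbb{N}}\,J_RA(n)\;\to\;J_R\,\forall n\,A(n),\qquad\text{where } J_RB:=(B\to R)\to B.$$ That is, whenever $\varepsilon_n$ modified realizes $(A(n)\to R)\to A(n)$ for all $n$, and $q$ modified realizes $\forall nA(n)\to R$, the sequence $\mathsf{ips}_0(\varepsilon)(q)$ modified realizes $\forall nA(n)$.
   Context: $\mathrm{HA}^\omega$ is Heyting arithmetic in all finite types with fully extensional equality (Troelstra's E-$\mathrm{HA}^\omega$); finite types are generated from $\mathbb{B}$ and $\mathbb{N}$ by products, function types and finite sequence types. "$t$ modified realizes $A$" is Kreisel's modified realizability (Troelstra 1973): in particular $f$ realizes $B\to C$ iff $f(x)$ realizes $C$ for every $x$ realizing $B$, and $f$ realizes $\forall nB(n)$ iff $f(n)$ realizes $B(n)$ for all $n$. $R$ denotes both the formula and the type of its realizers (a discrete type); $X_n$ denotes the type of realizers of $A(n)$ (which does not in fact depend on $n$), and $\Pi_iX_{i}$ the type of infinite sequences with $i$-th entry in $X_i$. $\mathsf{ips}$ (implicitly controlled product of selection functions). With $J_RX=(X\to R)\to X$ for types, $\varepsilon\colon\Pi_kJ_RX_k$ and $q\colon\Pi_iX_{i+n}\to R$, the value $\mathsf{ips}_n(\varepsilon)(q)\colon\Pi_iX_{i+n}$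 is specified by $$\mathsf{ips}_n(\varepsilon)(q)=c*\mathsf{ips}_{n+1}(\varepsilon)(q_c),\qquad c=\varepsilon_n(\lambda x.\,q_x(\mathsf{ips}_{n+1}(\varepsilon)(q_x))),$$ where $*$ is concatenation and $q_x(\alpha)=q(x*\alpha)$. $[\alpha](n)=\langle\alpha(0),\dots,\alpha(n-1)\rangle$. $\mathrm{CONT}$: for discrete $R$, $\forall q^{\Pi_iX_i\to R}\,\forall\alpha\,\exists n\,\forall\beta\,([\alpha](n)=[\beta](n)\to q(\alpha)=q(\beta))$. Discrete and compact types are generated by: compact $::=\mathbb{B}\mid$ compact $\times$ compact $\mid$ discrete $\to$ compact; discrete $::=\mathbb{B}\mid\mathbb{N}\mid$ discrete $\times$ discrete $\mid$ discrete$^*$ $\mid$ compact $\to$ discrete. $\mathrm{BI}$ (relativised bar induction) is the scheme, for arbitrary predicates $S,P$ on finite sequences: if $S(\langle\rangle)$, and for every infinite $\alpha$ with $S([\alpha](n))$ for all $n$ there is $n$ with $P([\alpha](n))$, and for all $s$ with $S(s)$: $\forall x[S(s*x)\to P(s*x)]\to P(s)$; then $P(\langle\rangle)$. *)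

theory Defs
  imports Main
begin

section \<open>Types, terms and formulas\<close>

datatype ty =
    TB
  | TN
  | TProd ty ty (infixr "\<otimes>" 65)
  | TFun ty ty (infixr "\<rightarrow>" 60)
  | TStar ty

inductive compact_ty :: "ty \<Rightarrow> bool" and discrete_ty :: "ty \<Rightarrow> bool" where
  "compact_ty TB"
| "compact_ty \<sigma> \<Longrightarrow> compact_ty \<tau> \<Longrightarrow> compact_ty (\<sigma> \<otimes> \<tau>)"
| "discrete_ty \<sigma> \<Longrightarrow> compact_ty \<tau> \<Longrightarrow> compact_ty (\<sigma> \<rightarrow> \<tau>)"
| "discrete_ty TB"
| "discrete_ty TN"
| "discrete_ty \<sigma> \<Longrightarrow> discrete_ty \<tau> \<Longrightarrow> discrete_ty (\<sigma> \<otimes> \<tau>)"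
| "discrete_ty \<sigma> \<Longrightarrow> discrete_ty (TStar \<sigma>)"
| "compact_ty \<sigma> \<Longrightarrow> discrete_ty \<tau> \<Longrightarrow> discrete_ty (\<sigma> \<rightarrow> \<tau>)"

datatype const =
    CTrue
  | CFalse
  | CIf ty
  | CZero
  | CSucc
  | CRec ty
  | CPair ty ty
  | CFst ty ty
  | CSnd ty ty
  | CNil ty
  | CSnoc ty
  | CLRec ty ty
  | CIps ty ty

primrec ctype :: "const \<Rightarrow> ty" where
  "ctype CTrue = TB"
| "ctype CFalse = TB"
| "ctype (CIf \<sigma>) = TB \<rightarrow> \<sigma> \<rightarrow> \<sigma> \<rightarrow> \<sigma>"
| "ctype CZero = TN"
| "ctype CSucc = TN \<rightarrow> TN"
| "ctype (CRec \<sigma>) = \<sigma> \<rightarrow> (TN \<rightarrow> \<sigma> \<rightarrow> \<sigma>) \<rightarrow> TN \<rightarrow> \<sigma>"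
| "ctype (CPair \<sigma> \<tau>) = \<sigma> \<rightarrow> \<tau> \<rightarrow> \<sigma> \<otimes> \<tau>"
| "ctype (CFst \<sigma> \<tau>) = \<sigma> \<otimes> \<tau> \<rightarrow> \<sigma>"
| "ctype (CSnd \<sigma> \<tau>) = \<sigma> \<otimes> \<tau> \<rightarrow> \<tau>"
| "ctype (CNil \<sigma>) = TStar \<sigma>"
| "ctype (CSnoc \<sigma>) = TStar \<sigma> \<rightarrow> \<sigma> \<rightarrow> TStar \<sigma>"
| "ctype (CLRec \<sigma> \<tau>) = \<tau> \<rightarrow> (TStar \<sigma> \<rightarrow> \<sigma> \<rightarrow> \<tau> \<rightarrow> \<tau>) \<rightarrow> TStar \<sigma> \<rightarrow> \<tau>"
| "ctype (CIps X R) =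
    TN \<rightarrow> (TN \<rightarrow> (X \<rightarrow> R) \<rightarrow> X) \<rightarrow> ((TN \<rightarrow> X) \<rightarrow> R) \<rightarrow> TN \<rightarrow> X"

text \<open>
  Variables are de Bruijn indices, in terms and in formulas alike. A typing context lists the
  types of the free variables, innermost binder first.
\<close>

datatype trm =
    Var nat
  | Con const
  | App trm trm (infixl "\<cdot>" 90)
  | Lam ty trm

inductive has_type :: "ty list \<Rightarrow> trm \<Rightarrow> ty \<Rightarrow> bool" where
  "i < length \<Gamma> \<Longrightarrow> has_type \<Gamma> (Var i) (\<Gamma> ! i)"
| "has_type \<Gamma> (Con c) (ctype c)"
| "has_type \<Gamma> t (\<sigma> \<rightarrow> \<tau>) \<Longrightarrow> has_type \<Gamma> s \<sigma> \<Longrightarrow> has_type \<Gamma> (t \<cdot> s) \<tau>"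
| "has_type (\<sigma> # \<Gamma>) t \<tau> \<Longrightarrow> has_type \<Gamma> (Lam \<sigma> t) (\<sigma> \<rightarrow> \<tau>)"

datatype fm =
    Bot
  | Eq ty trm trm
  | And fm fm
  | Or fm fm
  | Imp fm fm
  | Forall ty fm
  | Exists ty fm

primrec wff :: "ty list \<Rightarrow> fm \<Rightarrow> bool" where
  "wff \<Gamma> Bot \<longleftrightarrow> True"
| "wff \<Gamma> (Eq \<sigma> s t) \<longleftrightarrow> has_type \<Gamma> s \<sigma> \<and> has_type \<Gamma> t \<sigma>"
| "wff \<Gamma> (And A B) \<longleftrightarrow> wff \<Gamma> A \<and> wff \<Gamma> B"
| "wff \<Gamma> (Or A B) \<longleftrightarrow> wff \<Gamma> A \<and> wff \<Gamma> B"
| "wff \<Gamma> (Imp A B) \<longleftrightarrow> wff \<Gamma> A \<and> wff \<Gamma> B"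
| "wff \<Gamma> (Forall \<sigma> A) \<longleftrightarrow> wff (\<sigma> # \<Gamma>) A"
| "wff \<Gamma> (Exists \<sigma> A) \<longleftrightarrow> wff (\<sigma> # \<Gamma>) A"

section \<open>Substitution\<close>

primrec ren :: "(nat \<Rightarrow> nat) \<Rightarrow> trm \<Rightarrow> trm" where
  "ren f (Var i) = Var (f i)"
| "ren f (Con c) = Con c"
| "ren f (t \<cdot> s) = ren f t \<cdot> ren f s"
| "ren f (Lam \<sigma> t) = Lam \<sigma> (ren (case_nat 0 (\<lambda>i. Suc (f i))) t)"

definition up :: "(nat \<Rightarrow> trm) \<Rightarrow> nat \<Rightarrow> trm" where
  "up f = case_nat (Var 0) (\<lambda>i. ren Suc (f i))"

primrec tsub :: "(nat \<Rightarrow> trm) \<Rightarrow> trm \<Rightarrow> trm" where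
  "tsub f (Var i) = f i"
| "tsub f (Con c) = Con c"
| "tsub f (t \<cdot> s) = tsub f t \<cdot> tsub f s"
| "tsub f (Lam \<sigma> t) = Lam \<sigma> (tsub (up f) t)"

primrec fsub :: "(nat \<Rightarrow> trm) \<Rightarrow> fm \<Rightarrow> fm" where
  "fsub f Bot = Bot"
| "fsub f (Eq \<sigma> s t) = Eq \<sigma> (tsub f s) (tsub f t)"
| "fsub f (And A B) = And (fsub f A) (fsub f B)"
| "fsub f (Or A B) = Or (fsub f A) (fsub f B)"
| "fsub f (Imp A B) = Imp (fsub f A) (fsub f B)"
| "fsub f (Forall \<sigma> A) = Forall \<sigma> (fsub (up f) A)"
| "fsub f (Exists \<sigma> A) = Exists \<sigma> (fsub (up f) A)"

text \<open>
  \<open>tlift k\<close> and \<open>flift k\<close> move an expression under \<open>k\<close> further binders. \<open>plug k t A\<close> replaces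
  variable \<open>0\<close> of \<open>A\<close> by \<open>t\<close>, where \<open>t\<close> (and the result) lives under \<open>k\<close> further binders:
  if \<open>A\<close> is over \<open>\<sigma> # \<Gamma>\<close> and \<open>t : \<sigma>\<close> over \<open>\<Delta> @ \<Gamma>\<close> with \<open>length \<Delta> = k\<close>, then \<open>plug k t A\<close> is
  over \<open>\<Delta> @ \<Gamma>\<close>.
\<close>

definition tlift :: "nat \<Rightarrow> trm \<Rightarrow> trm" where
  "tlift k = tsub (\<lambda>i. Var (i + k))"

definition flift :: "nat \<Rightarrow> fm \<Rightarrow> fm" where
  "flift k = fsub (\<lambda>i. Var (i + k))"

definition tinst :: "trm \<Rightarrow> trm \<Rightarrow> trm" where
  "tinst t = tsub (case_nat t Var)"

definition plug :: "nat \<Rightarrow> trm \<Rightarrow> fm \<Rightarrow> fm" where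
  "plug k t = fsub (case_nat t (\<lambda>i. Var (i + k)))"

lemma size_fsub [simp]: "size (fsub f A) = size A"
  by (induction A arbitrary: f) simp_all

lemma size_flift [simp]: "size (flift k A) = size A"
  by (simp add: flift_def)

section \<open>Sequences and the functional ips\<close>

text \<open>\<open>initseg X \<alpha> n\<close> is \<open>[\<alpha>](n)\<close>, by recursion on \<open>n\<close>.\<close>

definition initseg :: "ty \<Rightarrow> trm \<Rightarrow> trm \<Rightarrow> trm" where
  "initseg X \<alpha> n =
    Con (CRec (TStar X)) \<cdot> Con (CNil X)
      \<cdot> Lam TN (Lam (TStar X) (Con (CSnoc X) \<cdot> Var 0 \<cdot> (tlift 2 \<alpha> \<cdot> Var 1))) \<cdot> n"

text \<open>
  \<open>seq_cons X x \<alpha>\<close> is \<open>x * \<alpha>\<close>, by recursion on the index, and \<open>fun_cons X q x\<close> is \<open>q\<^sub>x\<close>.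
\<close>

definition seq_cons :: "ty \<Rightarrow> trm \<Rightarrow> trm \<Rightarrow> trm" where
  "seq_cons X x \<alpha> = Con (CRec X) \<cdot> x \<cdot> Lam TN (Lam X (tlift 2 \<alpha> \<cdot> Var 1))"

definition fun_cons :: "ty \<Rightarrow> trm \<Rightarrow> trm \<Rightarrow> trm" where
  "fun_cons X q x = Lam (TN \<rightarrow> X) (tlift 1 q \<cdot> seq_cons X (tlift 1 x) (Var 0))"

definition ips :: "ty \<Rightarrow> ty \<Rightarrow> trm \<Rightarrow> trm \<Rightarrow> trm \<Rightarrow> trm" where
  "ips X R n \<epsilon> q = Con (CIps X R) \<cdot> n \<cdot> \<epsilon> \<cdot> q"

definition ips_head :: "ty \<Rightarrow> ty \<Rightarrow> trm \<Rightarrow> trm \<Rightarrow> trm \<Rightarrow> trm" where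
  "ips_head X R n \<epsilon> q =
    \<epsilon> \<cdot> n \<cdot> Lam X
      (fun_cons X (tlift 1 q) (Var 0)
        \<cdot> ips X R (Con CSucc \<cdot> tlift 1 n) (tlift 1 \<epsilon>) (fun_cons X (tlift 1 q) (Var 0)))"

text \<open>The bound variables are \<open>n\<close>, \<open>\<epsilon>\<close>, \<open>q\<close>, i.e. \<open>Var 2\<close>, \<open>Var 1\<close>, \<open>Var 0\<close>.\<close>

definition ips_equation :: "ty \<Rightarrow> ty \<Rightarrow> fm" where
  "ips_equation X R =
    Forall TN (Forall (TN \<rightarrow> (X \<rightarrow> R) \<rightarrow> X) (Forall ((TN \<rightarrow> X) \<rightarrow> R)
      (let c = ips_head X R (Var 2) (Var 1) (Var 0)
       in Eq (TN \<rightarrow> X) (ips X R (Var 2) (Var 1) (Var 0))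
            (seq_cons X c
              (ips X R (Con CSucc \<cdot> Var 2) (Var 1) (fun_cons X (Var 0) c))))))"

primrec ips_free_trm :: "trm \<Rightarrow> bool" where
  "ips_free_trm (Var i) \<longleftrightarrow> True"
| "ips_free_trm (Con c) \<longleftrightarrow> (\<forall>X R. c \<noteq> CIps X R)"
| "ips_free_trm (t \<cdot> s) \<longleftrightarrow> ips_free_trm t \<and> ips_free_trm s"
| "ips_free_trm (Lam \<sigma> t) \<longleftrightarrow> ips_free_trm t"

primrec ips_free :: "fm \<Rightarrow> bool" where
  "ips_free Bot \<longleftrightarrow> True"
| "ips_free (Eq \<sigma> s t) \<longleftrightarrow> ips_free_trm s \<and> ips_free_trm t"
| "ips_free (And A B) \<longleftrightarrow> ips_free A \<and> ips_free B"
| "ips_free (Or A B) \<longleftrightarrow> ips_free A \<and> ips_free B"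
| "ips_free (Imp A B) \<longleftrightarrow> ips_free A \<and> ips_free B"
| "ips_free (Forall \<sigma> A) \<longleftrightarrow> ips_free A"
| "ips_free (Exists \<sigma> A) \<longleftrightarrow> ips_free A"

definition HA_formula :: "ty list \<Rightarrow> fm \<Rightarrow> bool" where
  "HA_formula \<Gamma> A \<longleftrightarrow> wff \<Gamma> A \<and> ips_free A"

text \<open>Quantifier-free formulas with prime formulas of ground type, hence decidable.\<close>

primrec qf :: "fm \<Rightarrow> bool" where
  "qf Bot \<longleftrightarrow> True"
| "qf (Eq \<sigma> s t) \<longleftrightarrow> \<sigma> = TB \<or> \<sigma> = TN"
| "qf (And A B) \<longleftrightarrow> qf A \<and> qf B"
| "qf (Or A B) \<longleftrightarrow> qf A \<and> qf B"
| "qf (Imp A B) \<longleftrightarrow> qf A \<and> qf B"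
| "qf (Forall \<sigma> A) \<longleftrightarrow> False"
| "qf (Exists \<sigma> A) \<longleftrightarrow> False"

definition sigma01 :: "fm \<Rightarrow> bool" where
  "sigma01 R \<longleftrightarrow> (\<exists>R0. R = Exists TN R0 \<and> qf R0)"

section \<open>Axioms\<close>

text \<open>
  All schemes range over the language with the constants \<open>CIps\<close>. Equality is primitive at every
  type; \<open>ext\<close> makes it extensional.
\<close>

inductive HA_axiom :: "ty list \<Rightarrow> fm \<Rightarrow> bool" where
  refl: "has_type \<Gamma> t \<sigma> \<Longrightarrow> HA_axiom \<Gamma> (Eq \<sigma> t t)"
| leibniz: "has_type \<Gamma> s \<sigma> \<Longrightarrow> has_type \<Gamma> t \<sigma> \<Longrightarrow> wff (\<sigma> # \<Gamma>) A \<Longrightarrow>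
    HA_axiom \<Gamma> (Imp (Eq \<sigma> s t) (Imp (plug 0 s A) (plug 0 t A)))"
| beta: "has_type (\<sigma> # \<Gamma>) t \<tau> \<Longrightarrow> has_type \<Gamma> s \<sigma> \<Longrightarrow>
    HA_axiom \<Gamma> (Eq \<tau> (Lam \<sigma> t \<cdot> s) (tinst s t))"
| ext: "has_type \<Gamma> f (\<sigma> \<rightarrow> \<tau>) \<Longrightarrow> has_type \<Gamma> g (\<sigma> \<rightarrow> \<tau>) \<Longrightarrow>
    HA_axiom \<Gamma> (Imp (Forall \<sigma> (Eq \<tau> (tlift 1 f \<cdot> Var 0) (tlift 1 g \<cdot> Var 0)))
      (Eq (\<sigma> \<rightarrow> \<tau>) f g))"
| if_true: "has_type \<Gamma> s \<sigma> \<Longrightarrow> has_type \<Gamma> t \<sigma> \<Longrightarrow>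
    HA_axiom \<Gamma> (Eq \<sigma> (Con (CIf \<sigma>) \<cdot> Con CTrue \<cdot> s \<cdot> t) s)"
| if_false: "has_type \<Gamma> s \<sigma> \<Longrightarrow> has_type \<Gamma> t \<sigma> \<Longrightarrow>
    HA_axiom \<Gamma> (Eq \<sigma> (Con (CIf \<sigma>) \<cdot> Con CFalse \<cdot> s \<cdot> t) t)"
| bool_cases: "has_type \<Gamma> b TB \<Longrightarrow>
    HA_axiom \<Gamma> (Or (Eq TB b (Con CTrue)) (Eq TB b (Con CFalse)))"
| true_not_false: "HA_axiom \<Gamma> (Imp (Eq TB (Con CTrue) (Con CFalse)) Bot)"
| fst: "has_type \<Gamma> s \<sigma> \<Longrightarrow> has_type \<Gamma> t \<tau> \<Longrightarrow>
    HA_axiom \<Gamma> (Eq \<sigma> (Con (CFst \<sigma> \<tau>) \<cdot> (Con (CPair \<sigma> \<tau>) \<cdot> s \<cdot> t)) s)"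
| snd: "has_type \<Gamma> s \<sigma> \<Longrightarrow> has_type \<Gamma> t \<tau> \<Longrightarrow>
    HA_axiom \<Gamma> (Eq \<tau> (Con (CSnd \<sigma> \<tau>) \<cdot> (Con (CPair \<sigma> \<tau>) \<cdot> s \<cdot> t)) t)"
| surjective_pairing: "has_type \<Gamma> p (\<sigma> \<otimes> \<tau>) \<Longrightarrow>
    HA_axiom \<Gamma> (Eq (\<sigma> \<otimes> \<tau>)
      (Con (CPair \<sigma> \<tau>) \<cdot> (Con (CFst \<sigma> \<tau>) \<cdot> p) \<cdot> (Con (CSnd \<sigma> \<tau>) \<cdot> p)) p)"
| zero_not_succ: "has_type \<Gamma> t TN \<Longrightarrow>
    HA_axiom \<Gamma> (Imp (Eq TN (Con CSucc \<cdot> t) (Con CZero)) Bot)"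
| succ_inj: "has_type \<Gamma> s TN \<Longrightarrow> has_type \<Gamma> t TN \<Longrightarrow>
    HA_axiom \<Gamma> (Imp (Eq TN (Con CSucc \<cdot> s) (Con CSucc \<cdot> t)) (Eq TN s t))"
| rec_zero: "has_type \<Gamma> a \<sigma> \<Longrightarrow> has_type \<Gamma> f (TN \<rightarrow> \<sigma> \<rightarrow> \<sigma>) \<Longrightarrow>
    HA_axiom \<Gamma> (Eq \<sigma> (Con (CRec \<sigma>) \<cdot> a \<cdot> f \<cdot> Con CZero) a)"
| rec_succ: "has_type \<Gamma> a \<sigma> \<Longrightarrow> has_type \<Gamma> f (TN \<rightarrow> \<sigma> \<rightarrow> \<sigma>) \<Longrightarrow> has_type \<Gamma> n TN \<Longrightarrow>
    HA_axiom \<Gamma> (Eq \<sigma> (Con (CRec \<sigma>) \<cdot> a \<cdot> f \<cdot> (Con CSucc \<cdot> n))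
      (f \<cdot> n \<cdot> (Con (CRec \<sigma>) \<cdot> a \<cdot> f \<cdot> n)))"
| induction: "wff (TN # \<Gamma>) A \<Longrightarrow>
    HA_axiom \<Gamma> (Imp (plug 0 (Con CZero) A)
      (Imp (Forall TN (Imp A (plug 1 (Con CSucc \<cdot> Var 0) A))) (Forall TN A)))"
| lrec_nil: "has_type \<Gamma> a \<tau> \<Longrightarrow> has_type \<Gamma> f (TStar \<sigma> \<rightarrow> \<sigma> \<rightarrow> \<tau> \<rightarrow> \<tau>) \<Longrightarrow>
    HA_axiom \<Gamma> (Eq \<tau> (Con (CLRec \<sigma> \<tau>) \<cdot> a \<cdot> f \<cdot> Con (CNil \<sigma>)) a)"
| lrec_snoc: "has_type \<Gamma> a \<tau> \<Longrightarrow> has_type \<Gamma> f (TStar \<sigma> \<rightarrow> \<sigma> \<rightarrow> \<tau> \<rightarrow> \<tau>) \<Longrightarrow>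
    has_type \<Gamma> s (TStar \<sigma>) \<Longrightarrow> has_type \<Gamma> x \<sigma> \<Longrightarrow>
    HA_axiom \<Gamma> (Eq \<tau> (Con (CLRec \<sigma> \<tau>) \<cdot> a \<cdot> f \<cdot> (Con (CSnoc \<sigma>) \<cdot> s \<cdot> x))
      (f \<cdot> s \<cdot> x \<cdot> (Con (CLRec \<sigma> \<tau>) \<cdot> a \<cdot> f \<cdot> s)))"
| list_induction: "wff (TStar \<sigma> # \<Gamma>) A \<Longrightarrow>
    HA_axiom \<Gamma> (Imp (plug 0 (Con (CNil \<sigma>)) A)
      (Imp (Forall (TStar \<sigma>) (Forall \<sigma>
              (Imp (plug 2 (Var 1) A) (plug 2 (Con (CSnoc \<sigma>) \<cdot> Var 1 \<cdot> Var 0) A))))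
        (Forall (TStar \<sigma>) A)))"

text \<open>\<open>S\<close> and \<open>P\<close> are formulas whose variable \<open>0\<close> ranges over \<open>TStar X\<close>.\<close>

definition BI :: "ty \<Rightarrow> fm \<Rightarrow> fm \<Rightarrow> fm" where
  "BI X S P =
    Imp (plug 0 (Con (CNil X)) S)
    (Imp (Forall (TN \<rightarrow> X)
            (Imp (Forall TN (plug 2 (initseg X (Var 1) (Var 0)) S))
                 (Exists TN (plug 2 (initseg X (Var 1) (Var 0)) P))))
    (Imp (Forall (TStar X)
            (Imp S
              (Imp (Forall X (Imp (plug 2 (Con (CSnoc X) \<cdot> Var 1 \<cdot> Var 0) S)
                                  (plug 2 (Con (CSnoc X) \<cdot> Var 1 \<cdot> Var 0) P)))
                   P)))
    (plug 0 (Con (CNil X)) P)))"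

text \<open>The bound variables are \<open>q\<close>, \<open>\<alpha>\<close>, \<open>n\<close>, \<open>\<beta>\<close>, i.e. \<open>Var 3\<close>, \<dots>, \<open>Var 0\<close>.\<close>

definition CONT :: "ty \<Rightarrow> ty \<Rightarrow> fm" where
  "CONT X R =
    Forall ((TN \<rightarrow> X) \<rightarrow> R) (Forall (TN \<rightarrow> X) (Exists TN (Forall (TN \<rightarrow> X)
      (Imp (Eq (TStar X) (initseg X (Var 2) (Var 1)) (initseg X (Var 0) (Var 1)))
           (Eq R (Var 3 \<cdot> Var 2) (Var 3 \<cdot> Var 0))))))"

text \<open>
  As with \<open>CONT\<close>, the equation of \<open>ips\<close> is postulated for discrete \<open>R\<close> only, since its solvability
  rests on continuity of \<open>q\<close>; \<open>X\<close> is arbitrary.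
\<close>

inductive theory_axiom :: "ty list \<Rightarrow> fm \<Rightarrow> bool" where
  HA: "HA_axiom \<Gamma> A \<Longrightarrow> theory_axiom \<Gamma> A"
| BI: "wff (TStar X # \<Gamma>) S \<Longrightarrow> wff (TStar X # \<Gamma>) P \<Longrightarrow> theory_axiom \<Gamma> (BI X S P)"
| CONT: "discrete_ty R \<Longrightarrow> theory_axiom \<Gamma> (CONT X R)"
| ips: "discrete_ty R \<Longrightarrow> theory_axiom \<Gamma> (ips_equation X R)"

section \<open>Derivability\<close>

text \<open>
  \<open>\<Gamma>; H \<turnstile> A\<close> is derivability in intuitionistic natural deduction from the hypotheses \<open>H\<close> and the
  axioms of HA\<open>\<^sup>\<omega>\<close> + BI + CONT + ips, all formulas being over the typing context \<open>\<Gamma>\<close>.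
\<close>

inductive derivable :: "ty list \<Rightarrow> fm list \<Rightarrow> fm \<Rightarrow> bool" ("_; _ \<turnstile> _" [50, 50, 50] 50) where
  ax: "theory_axiom \<Gamma> A \<Longrightarrow> \<Gamma>; H \<turnstile> A"
| hyp: "A \<in> set H \<Longrightarrow> \<Gamma>; H \<turnstile> A"
| BotE: "\<Gamma>; H \<turnstile> Bot \<Longrightarrow> wff \<Gamma> A \<Longrightarrow> \<Gamma>; H \<turnstile> A"
| AndI: "\<Gamma>; H \<turnstile> A \<Longrightarrow> \<Gamma>; H \<turnstile> B \<Longrightarrow> \<Gamma>; H \<turnstile> And A B"
| AndE1: "\<Gamma>; H \<turnstile> And A B \<Longrightarrow> \<Gamma>; H \<turnstile> A"
| AndE2: "\<Gamma>; H \<turnstile> And A B \<Longrightarrow> \<Gamma>; H \<turnstile> B"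
| OrI1: "\<Gamma>; H \<turnstile> A \<Longrightarrow> wff \<Gamma> B \<Longrightarrow> \<Gamma>; H \<turnstile> Or A B"
| OrI2: "\<Gamma>; H \<turnstile> B \<Longrightarrow> wff \<Gamma> A \<Longrightarrow> \<Gamma>; H \<turnstile> Or A B"
| OrE: "\<Gamma>; H \<turnstile> Or A B \<Longrightarrow> \<Gamma>; A # H \<turnstile> C \<Longrightarrow> \<Gamma>; B # H \<turnstile> C \<Longrightarrow> \<Gamma>; H \<turnstile> C"
| ImpI: "\<Gamma>; A # H \<turnstile> B \<Longrightarrow> wff \<Gamma> A \<Longrightarrow> \<Gamma>; H \<turnstile> Imp A B"
| ImpE: "\<Gamma>; H \<turnstile> Imp A B \<Longrightarrow> \<Gamma>; H \<turnstile> A \<Longrightarrow> \<Gamma>; H \<turnstile> B"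
| ForallI: "\<sigma> # \<Gamma>; map (flift 1) H \<turnstile> A \<Longrightarrow> \<Gamma>; H \<turnstile> Forall \<sigma> A"
| ForallE: "\<Gamma>; H \<turnstile> Forall \<sigma> A \<Longrightarrow> has_type \<Gamma> t \<sigma> \<Longrightarrow> \<Gamma>; H \<turnstile> plug 0 t A"
| ExistsI: "\<Gamma>; H \<turnstile> plug 0 t A \<Longrightarrow> has_type \<Gamma> t \<sigma> \<Longrightarrow> wff (\<sigma> # \<Gamma>) A \<Longrightarrow> \<Gamma>; H \<turnstile> Exists \<sigma> A"
| ExistsE: "\<Gamma>; H \<turnstile> Exists \<sigma> A \<Longrightarrow> \<sigma> # \<Gamma>; A # map (flift 1) H \<turnstile> flift 1 C \<Longrightarrow> \<Gamma>; H \<turnstile> C"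

section \<open>Modified realizability\<close>

text \<open>
  There is no unit type, so \<open>TB\<close> serves as the type of the (contentless) realizers of prime
  formulas; every element of it realizes a true prime formula.
\<close>

primrec rty :: "fm \<Rightarrow> ty" where
  "rty Bot = TB"
| "rty (Eq \<sigma> s t) = TB"
| "rty (And A B) = rty A \<otimes> rty B"
| "rty (Or A B) = TB \<otimes> rty A \<otimes> rty B"
| "rty (Imp A B) = rty A \<rightarrow> rty B"
| "rty (Forall \<sigma> A) = \<sigma> \<rightarrow> rty A"
| "rty (Exists \<sigma> A) = \<sigma> \<otimes> rty A"

text \<open>
  \<open>mr t A\<close> is the formula ``\<open>t\<close> modified realizes \<open>A\<close>''. A realizer of a disjunction consists of a
  tag and of candidate realizers of both disjuncts, of which the tag selects one.
\<close>

function mr :: "trm \<Rightarrow> fm \<Rightarrow> fm" where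
  "mr t Bot = Bot"
| "mr t (Eq \<sigma> u v) = Eq \<sigma> u v"
| "mr t (And A B) =
    And (mr (Con (CFst (rty A) (rty B)) \<cdot> t) A) (mr (Con (CSnd (rty A) (rty B)) \<cdot> t) B)"
| "mr t (Or A B) =
    (let tag = Con (CFst TB (rty A \<otimes> rty B)) \<cdot> t;
         r = Con (CSnd TB (rty A \<otimes> rty B)) \<cdot> t
     in And (Imp (Eq TB tag (Con CTrue)) (mr (Con (CFst (rty A) (rty B)) \<cdot> r) A))
            (Imp (Eq TB tag (Con CFalse)) (mr (Con (CSnd (rty A) (rty B)) \<cdot> r) B)))"
| "mr t (Imp A B) =
    Forall (rty A) (Imp (mr (Var 0) (flift 1 A)) (mr (tlift 1 t \<cdot> Var 0) (flift 1 B)))"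
| "mr t (Forall \<sigma> A) = Forall \<sigma> (mr (tlift 1 t \<cdot> Var 0) A)"
| "mr t (Exists \<sigma> A) =
    mr (Con (CSnd \<sigma> (rty A)) \<cdot> t) (plug 0 (Con (CFst \<sigma> (rty A)) \<cdot> t) A)"
  by pat_completeness auto
termination
  by (relation "measure (\<lambda>(t, A). size A)") (simp_all add: plug_def)

section \<open>The J-shift\<close>

definition J :: "fm \<Rightarrow> fm \<Rightarrow> fm" where
  "J R B = Imp (Imp B R) B"

text \<open>\<open>A\<close> has the additional variable \<open>0\<close> for \<open>n\<close>, on which \<open>R\<close> does not depend.\<close>

definition J_shift :: "fm \<Rightarrow> fm \<Rightarrow> fm" where
  "J_shift R A = Imp (Forall TN (J (flift 1 R) A)) (J R (Forall TN A))"

end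

theory Submission
  imports Defs
begin

text \<open>
  Bar induction is applied to \<open>S(s)\<close>, ``every entry \<open>s\<^sub>i\<close> realizes \<open>A(i)\<close>'', and \<open>P(s)\<close>,
  ``\<open>s * ips\<^bsub>|s|\<^esub>(\<epsilon>)(q\<^sub>s)\<close> realizes \<open>\<forall>n A(n)\<close>''. If all initial segments of \<open>\<alpha>\<close> satisfy \<open>S\<close>, then
  \<open>q(\<alpha>)\<close> realizes \<open>R\<close> and, by continuity, so do all values of \<open>q\<^sub>s\<close> for some \<open>s = [\<alpha>](n)\<close>; under
  such a \<open>q\<^sub>s\<close> the continuation passed to each selection function trivially realizes \<open>A(m) \<rightarrow> R\<close>, so
  every entry that \<open>ips\<close> produces is correct. In the induction step the hypothesis says
  that \<open>\<lambda>x. q\<^sub>s(x * ips\<^bsub>|s|+1\<^esub>(\<epsilon>)(q\<^bsub>s*x\<^esub>))\<close> realizes \<open>A(|s|) \<rightarrow> R\<close>; hence the head \<open>c\<close> chosen by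
  \<open>\<epsilon>\<close> realizes \<open>A(|s|)\<close>, and the hypothesis at \<open>s * c\<close> is \<open>P(s)\<close> by the equation of \<open>ips\<close>.
\<close>

section \<open>Substitution and typing\<close>

text \<open>Since \<open>A\<close> is arbitrary, realizing it is in general undecidable, and it
  enters the bar induction only through the two realizability hypotheses and invariance under
  provable equality. This is why realizability is abstracted to formulas \<open>M\<close> and
  \<open>Q\<close>, and why all work on sequences is done by provable equations. Bar induction has
  to be relativised: continuity gives an n for every \<alpha>, but q(\<alpha>) is known to realize R
  only if all entries of \<alpha> are correct. A second obstacle is one of direction. Finite
  sequences grow at the end by \<open>CSnoc\<close>, whereas the equation of \<open>ips\<close> adds
  an entry at the front of a tail; \<open>prepend\<close> and \<open>q_after\<close> convert one
  into the other. The hypothesis \<open>sigma01 R\<close> enters through discreteness of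
  \<open>rty R\<close>, which licenses both \<open>CONT\<close> and the equation of
  \<open>ips\<close>.\<close>

definition wk :: "nat \<Rightarrow> trm" where "wk i = Var (Suc i)"
definition inst :: "trm \<Rightarrow> nat \<Rightarrow> trm" where "inst t = case_nat t Var"

lemma wk_simps [simp]: "wk i = Var (Suc i)" by (simp add: wk_def)
lemma inst_simps [simp]: "inst t 0 = t" "inst t (Suc i) = Var i"
  by (simp_all add: inst_def)

text \<open>Listed one by one, since a rule for arbitrary numerals would loop with \<open>Suc_numeral\<close>.\<close>

lemma Var_numeral [simp]:
  "Var 2 = Var (Suc (Suc 0))"
  "Var 3 = Var (Suc (Suc (Suc 0)))"
  "Var 4 = Var (Suc (Suc (Suc (Suc 0))))"
  "Var 5 = Var (Suc (Suc (Suc (Suc (Suc 0)))))"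
  by (simp_all add: numeral_eq_Suc)

text \<open>Start of the fusion laws, in the order forced by \<open>up\<close>, which lifts by
  \<open>ren\<close>: composing substitutions under a binder needs both mixed laws, and
  \<open>ren_tsub\<close> in turn needs \<open>ren_ren\<close>.\<close>

lemma ren_ren: "ren f (ren g t) = ren (\<lambda>i. f (g i)) t"
proof (induction t arbitrary: f g)
  case (Lam \<sigma> t)
  have "(\<lambda>i. case_nat 0 (\<lambda>i. Suc (f i)) (case_nat 0 (\<lambda>i. Suc (g i)) i))
      = case_nat 0 (\<lambda>i. Suc (f (g i)))"
    by (auto split: nat.split)
  then show ?case using Lam by simp
qed simp_all

lemma up_Var [simp]: "up Var = Var"
  by (auto simp: up_def split: nat.split)

lemma tsub_ren: "tsub f (ren g t) = tsub (\<lambda>i. f (g i)) t"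
proof (induction t arbitrary: f g)
  case (Lam \<sigma> t)
  have "(\<lambda>i. up f (case_nat 0 (\<lambda>i. Suc (g i)) i)) = up (\<lambda>i. f (g i))"
    by (auto simp: up_def split: nat.split)
  then show ?case using Lam by simp
qed simp_all

lemma ren_tsub: "ren f (tsub g t) = tsub (\<lambda>i. ren f (g i)) t"
proof (induction t arbitrary: f g)
  case (Lam \<sigma> t)
  have "(\<lambda>i. ren (case_nat 0 (\<lambda>i. Suc (f i))) (up g i)) = up (\<lambda>i. ren f (g i))"
    by (auto simp: up_def ren_ren split: nat.split)
  then show ?case using Lam by simp
qed simp_all

lemma up_tsub: "(\<lambda>i. tsub (up f) (up g i)) = up (\<lambda>i. tsub f (g i))"
proof
  fix i show "tsub (up f) (up g i) = up (\<lambda>i. tsub f (g i)) i"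
    by (cases i) (simp_all add: up_def tsub_ren ren_tsub)
qed

lemma tsub_tsub: "tsub f (tsub g t) = tsub (\<lambda>i. tsub f (g i)) t"
  by (induction t arbitrary: f g) (simp_all add: up_tsub)

lemma tsub_Var [simp]: "tsub Var t = t"
  by (induction t) simp_all

lemma ren_eq_tsub: "ren f t = tsub (\<lambda>i. Var (f i)) t"
  using tsub_ren[of Var f t] by simp

lemma fsub_fsub: "fsub f (fsub g A) = fsub (\<lambda>i. tsub f (g i)) A"
  by (induction A arbitrary: f g) (simp_all add: tsub_tsub up_tsub)

lemma fsub_Var [simp]: "fsub Var A = A"
  by (induction A) simp_all

lemma ren_Suc: "ren Suc = tsub wk"
  by (rule HOL.ext) (simp add: ren_eq_tsub wk_def[abs_def])

lemma up_simps [simp]: "up f 0 = Var 0" "up f (Suc i) = tsub wk (f i)"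
  by (simp_all add: up_def ren_Suc)

lemma tsub_inst_wk [simp]: "tsub (inst t) (tsub wk u) = u"
  by (simp add: tsub_tsub)

lemma tsub_up_wk [simp]: "tsub (up f) (tsub wk u) = tsub wk (tsub f u)"
  by (simp add: tsub_tsub)

lemma fsub_inst_wk [simp]: "fsub (inst t) (fsub wk A) = A"
  by (simp add: fsub_fsub)

lemma fsub_up_wk [simp]: "fsub (up f) (fsub wk A) = fsub wk (fsub f A)"
  by (simp add: fsub_fsub)

text \<open>The versions below one and two binders serve predicates whose own arguments are
  variables 0 and 1 while the context beneath them changes. The rules move \<open>wk\<close>
  outwards or cancel it against \<open>inst\<close>.\<close>

lemma fsub_up_inst_up_wk [simp]: "fsub (up (inst t)) (fsub (up wk) A) = A"
  by (simp add: fsub_fsub up_tsub)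

lemma fsub_up_up_up_wk [simp]:
  "fsub (up (up f)) (fsub (up wk) A) = fsub (up wk) (fsub (up f) A)"
  by (simp add: fsub_fsub up_tsub)

lemma fsub_up_up_inst_up_up_wk [simp]: "fsub (up (up (inst t))) (fsub (up (up wk)) A) = A"
  by (simp add: fsub_fsub up_tsub)

lemma fsub_up_up_up_up_wk [simp]:
  "fsub (up (up (up f))) (fsub (up (up wk)) A) = fsub (up (up wk)) (fsub (up (up f)) A)"
  by (simp add: fsub_fsub up_tsub)

text \<open>Stated for \<open>Suc 0\<close> because the simplifier rewrites the numeral
  \<open>1\<close> of the definitions to it. These rules turn liftings into iterated
  \<open>wk\<close>.\<close>

lemma tlift_1 [simp]: "tlift (Suc 0) = tsub wk"
  by (simp add: tlift_def wk_def[abs_def])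

lemma tlift_2 [simp]: "tlift 2 t = tsub wk (tsub wk t)"
  by (simp add: tlift_def tsub_tsub)

lemma flift_1 [simp]: "flift (Suc 0) = fsub wk"
  by (simp add: flift_def wk_def[abs_def])

lemma tinst_eq [simp]: "tinst t = tsub (inst t)"
  by (simp add: tinst_def inst_def)

lemma plug_0 [simp]: "plug 0 t = fsub (inst t)"
  by (simp add: plug_def inst_def)

text \<open>Named forms of the substitutions in \<open>plug 1\<close> and \<open>plug 2\<close>,
  which come from the induction schemes and from \<open>BI\<close>.\<close>

definition wkinst :: "trm \<Rightarrow> nat \<Rightarrow> trm" where "wkinst t = case_nat t (\<lambda>i. Var (Suc i))"
definition wk2inst :: "trm \<Rightarrow> nat \<Rightarrow> trm" where "wk2inst t = case_nat t (\<lambda>i. Var (Suc (Suc i)))"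

lemma plug_1 [simp]: "plug (Suc 0) t A = fsub (wkinst t) A"
  by (simp add: plug_def wkinst_def)

lemma plug_2 [simp]: "plug 2 t A = fsub (wk2inst t) A"
  by (simp add: plug_def wk2inst_def)

lemma wkinst_simps [simp]: "wkinst t 0 = t" "wkinst t (Suc i) = Var (Suc i)"
    "wk2inst t 0 = t" "wk2inst t (Suc i) = Var (Suc (Suc i))"
  by (simp_all add: wkinst_def wk2inst_def)

lemma tsub_wkinst_wk [simp]: "tsub (wkinst t) (tsub wk u) = tsub wk u"
    "tsub (wk2inst t) (tsub wk u) = tsub wk (tsub wk u)"
  by (simp_all add: tsub_tsub wk_def[abs_def])

lemma fsub_up_up_wkinst [simp]:
   "fsub (up (up (wkinst t))) (fsub (up (up wk)) A) = fsub (up (up wk)) A"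
   "fsub (up (up (wk2inst t))) (fsub (up (up wk)) A) = fsub (up (up wk)) (fsub (up (up wk)) A)"
   "fsub (up (wkinst t)) (fsub (up wk) A) = fsub (up wk) A"
  by (simp_all add: fsub_fsub up_tsub wk_def[abs_def])

text \<open>Types are unique, so typing can be computed; every typing side condition becomes a task
  for the simplifier.\<close>

fun tyof :: "ty list \<Rightarrow> trm \<Rightarrow> ty option" where
  "tyof \<Gamma> (Var i) = (if i < length \<Gamma> then Some (\<Gamma> ! i) else None)"
| "tyof \<Gamma> (Con c) = Some (ctype c)"
| "tyof \<Gamma> (t \<cdot> s) = (case tyof \<Gamma> t of
      Some (\<sigma> \<rightarrow> \<tau>) \<Rightarrow> if tyof \<Gamma> s = Some \<sigma> then Some \<tau> else None
    | _ \<Rightarrow> None)"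
| "tyof \<Gamma> (Lam \<sigma> t) = map_option (TFun \<sigma>) (tyof (\<sigma> # \<Gamma>) t)"

lemma has_type_iff [simp]: "has_type \<Gamma> t \<tau> \<longleftrightarrow> tyof \<Gamma> t = Some \<tau>"
proof
  show "has_type \<Gamma> t \<tau> \<Longrightarrow> tyof \<Gamma> t = Some \<tau>"
    by (induction rule: has_type.induct) simp_all
  show "tyof \<Gamma> t = Some \<tau> \<Longrightarrow> has_type \<Gamma> t \<tau>"
  proof (induction t arbitrary: \<Gamma> \<tau>)
    case (Con c)
    then show ?case using has_type.intros(2) by auto
  next
    case (App t s)
    then obtain \<sigma> where "tyof \<Gamma> t = Some (\<sigma> \<rightarrow> \<tau>)" "tyof \<Gamma> s = Some \<sigma>"
      by (auto split: option.splits ty.splits if_splits)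
    then show ?case using App.IH has_type.intros(3) by blast
  qed (auto split: option.splits ty.splits if_splits intro: has_type.intros)
qed

text \<open>The premise also covers indices out of range. The conclusion is therefore an equation
  that holds for untypable terms too, so that \<open>tyof_wk\<close> can be an unconditional rewrite
  rule.\<close>

lemma tyof_ren:
  assumes "\<And>i. tyof \<Delta> (Var (f i)) = tyof \<Gamma> (Var i)"
  shows "tyof \<Delta> (ren f t) = tyof \<Gamma> t"
  using assms
proof (induction t arbitrary: \<Delta> \<Gamma> f)
  case (App t s)
  show ?case using App.IH[OF App.prems] by (simp cong: option.case_cong ty.case_cong)
next
  case (Lam \<sigma> t)
  have "tyof (\<sigma> # \<Delta>) (Var (case_nat 0 (\<lambda>i. Suc (f i)) i)) = tyof (\<sigma> # \<Gamma>) (Var i)" for i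
    using Lam.prems[of "i - 1"] by (cases i) (simp_all split: if_splits)
  from Lam.IH[OF this] show ?case by simp
qed simp_all

lemma tyof_wk [simp]: "tyof (\<sigma> # \<Gamma>) (tsub wk t) = tyof \<Gamma> t"
  using tyof_ren[of "\<sigma> # \<Gamma>" Suc \<Gamma> t] by (simp add: ren_Suc)

definition typed_sub :: "ty list \<Rightarrow> ty list \<Rightarrow> (nat \<Rightarrow> trm) \<Rightarrow> bool" where
  "typed_sub \<Gamma> \<Delta> f \<longleftrightarrow> (\<forall>i < length \<Gamma>. tyof \<Delta> (f i) = Some (\<Gamma> ! i))"

lemma typed_sub_up [simp]: "typed_sub \<Gamma> \<Delta> f \<Longrightarrow> typed_sub (\<sigma> # \<Gamma>) (\<sigma> # \<Delta>) (up f)"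
  unfolding typed_sub_def
proof (intro allI impI)
  fix i
  assume *: "\<forall>i<length \<Gamma>. tyof \<Delta> (f i) = Some (\<Gamma> ! i)" and "i < length (\<sigma> # \<Gamma>)"
  then show "tyof (\<sigma> # \<Delta>) (up f i) = Some ((\<sigma> # \<Gamma>) ! i)"
    by (cases i) auto
qed

lemma typed_sub_wk [simp]: "typed_sub \<Gamma> (\<sigma> # \<Gamma>) wk"
  by (simp add: typed_sub_def)

lemma typed_sub_inst [simp]: "tyof \<Gamma> t = Some \<sigma> \<Longrightarrow> typed_sub (\<sigma> # \<Gamma>) \<Gamma> (inst t)"
  by (auto simp: typed_sub_def inst_def split: nat.split)

lemma tyof_tsub: "typed_sub \<Gamma> \<Delta> f \<Longrightarrow> tyof \<Gamma> t = Some \<tau> \<Longrightarrow> tyof \<Delta> (tsub f t) = Some \<tau>"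
proof (induction t arbitrary: \<Gamma> \<Delta> f \<tau>)
  case (App t s)
  show ?case using App.IH[OF App.prems(1)] App.prems(2)
    by (auto split: option.splits ty.splits if_splits)
next
  case (Lam \<sigma> t)
  show ?case using Lam.IH[OF typed_sub_up[OF Lam.prems(1)]] Lam.prems(2) by auto
qed (auto simp: typed_sub_def split: if_splits)

lemma wff_fsub: "typed_sub \<Gamma> \<Delta> f \<Longrightarrow> wff \<Gamma> A \<Longrightarrow> wff \<Delta> (fsub f A)"
proof (induction A arbitrary: \<Gamma> \<Delta> f)
  case (Forall \<sigma> A)
  show ?case using Forall.IH[OF typed_sub_up[OF Forall.prems(1)]] Forall.prems(2) by simp
next
  case (Exists \<sigma> A)
  show ?case using Exists.IH[OF typed_sub_up[OF Exists.prems(1)]] Exists.prems(2) by simp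
qed (auto intro: tyof_tsub)

section \<open>Realizability under substitution\<close>

lemma rty_fsub [simp]: "rty (fsub f A) = rty A"
  by (induction A arbitrary: f) simp_all

lemma fsub_inst: "fsub f (fsub (inst t) A) = fsub (inst (tsub f t)) (fsub (up f) A)"
proof -
  have "(\<lambda>i. tsub f (inst t i)) = (\<lambda>i. tsub (inst (tsub f t)) (up f i))"
  proof
    fix i show "tsub f (inst t i) = tsub (inst (tsub f t)) (up f i)"
      by (cases i) simp_all
  qed
  then show ?thesis by (simp add: fsub_fsub)
qed

text \<open>Allows \<open>mr\<close> with a variable as realizer to act as a predicate. The
  existential case needs \<open>fsub_inst\<close>, because \<open>mr\<close> plugs a component of
  the realizer into the formula itself.\<close>

lemma fsub_mr [simp]: "fsub f (mr t A) = mr (tsub f t) (fsub f A)"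
  by (induction t A arbitrary: f rule: mr.induct) (simp_all add: Let_def fsub_inst)

lemma wff_mr [simp]: "wff \<Gamma> A \<Longrightarrow> tyof \<Gamma> t = Some (rty A) \<Longrightarrow> wff \<Gamma> (mr t A)"
proof (induction t A arbitrary: \<Gamma> rule: mr.induct)
  case (5 t A B)
  then show ?case by (simp add: wff_fsub[OF typed_sub_wk])
next
  case (7 t \<sigma> A)
  then show ?case by (simp add: wff_fsub[OF typed_sub_inst])
qed (simp_all add: Let_def)

section \<open>Derived rules and provable equality\<close>

lemma weaken: "\<Gamma>; H \<turnstile> A \<Longrightarrow> set H \<subseteq> set H' \<Longrightarrow> \<Gamma>; H' \<turnstile> A"
proof (induction arbitrary: H' rule: derivable.induct)
  case (OrE \<Gamma> H A B C)
  have "set (A # H) \<subseteq> set (A # H')" "set (B # H) \<subseteq> set (B # H')" using OrE.prems by auto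
  then show ?case using OrE derivable.OrE by blast
next
  case (ImpI \<Gamma> A H B)
  have "set (A # H) \<subseteq> set (A # H')" using ImpI.prems by auto
  then show ?case using ImpI derivable.ImpI by blast
next
  case (ForallI \<sigma> \<Gamma> H A)
  have "set (map (flift 1) H) \<subseteq> set (map (flift 1) H')" using ForallI.prems by auto
  then show ?case using ForallI derivable.ForallI by blast
next
  case (ExistsE \<Gamma> H \<sigma> A C)
  have "set (A # map (flift 1) H) \<subseteq> set (A # map (flift 1) H')" using ExistsE.prems by auto
  then show ?case using ExistsE derivable.ExistsE by blast
next
  case (ForallE \<Gamma> H \<sigma> A t)
  then show ?case using derivable.ForallE by blast
next
  case (ExistsI \<Gamma> H t A \<sigma>)
  then show ?case using derivable.ExistsI by blast
qed (auto intro: derivable.intros)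

lemma HA_derivable: "HA_axiom \<Gamma> A \<Longrightarrow> \<Gamma>; H \<turnstile> A"
  by (rule ax, rule theory_axiom.HA)

lemma all_intro: "\<sigma> # \<Gamma>; map (fsub wk) H \<turnstile> A \<Longrightarrow> \<Gamma>; H \<turnstile> Forall \<sigma> A"
  using ForallI[of \<sigma> \<Gamma> H A] by simp

lemma all_elim: "\<Gamma>; H \<turnstile> Forall \<sigma> A \<Longrightarrow> tyof \<Gamma> t = Some \<sigma> \<Longrightarrow> \<Gamma>; H \<turnstile> fsub (inst t) A"
  using ForallE[of \<Gamma> H \<sigma> A t] by simp

lemma ex_intro:
  "\<Gamma>; H \<turnstile> fsub (inst t) A \<Longrightarrow> tyof \<Gamma> t = Some \<sigma> \<Longrightarrow> wff (\<sigma> # \<Gamma>) A \<Longrightarrow> \<Gamma>; H \<turnstile> Exists \<sigma> A"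
  using ExistsI[of \<Gamma> H t A \<sigma>] by simp

lemma ex_elim:
  "\<Gamma>; H \<turnstile> Exists \<sigma> A \<Longrightarrow> \<sigma> # \<Gamma>; A # map (fsub wk) H \<turnstile> fsub wk C \<Longrightarrow> \<Gamma>; H \<turnstile> C"
  using ExistsE[of \<Gamma> H \<sigma> A C] by simp

lemma hyp_wk: "A \<in> set H \<Longrightarrow> fsub wk A \<in> set (map (fsub wk) H)"
  by simp

lemma leibniz_subst:
  assumes "\<Gamma>; H \<turnstile> Eq \<sigma> s t" "tyof \<Gamma> s = Some \<sigma>" "tyof \<Gamma> t = Some \<sigma>" "wff (\<sigma> # \<Gamma>) B"
    and "\<Gamma>; H \<turnstile> fsub (inst s) B"
  shows "\<Gamma>; H \<turnstile> fsub (inst t) B"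
proof -
  have "\<Gamma>; H \<turnstile> Imp (Eq \<sigma> s t) (Imp (fsub (inst s) B) (fsub (inst t) B))"
    using HA_derivable[OF HA_axiom.leibniz[of \<Gamma> s \<sigma> t B]] assms by simp
  then show ?thesis using assms ImpE by blast
qed

text \<open>Typing is bundled in because it does not follow from derivability: the rule
  \<open>hyp\<close> accepts ill-formed hypotheses. With it, equational chains carry their own side
  conditions.\<close>

definition deq :: "ty list \<Rightarrow> fm list \<Rightarrow> ty \<Rightarrow> trm \<Rightarrow> trm \<Rightarrow> bool" where
  "deq \<Gamma> H \<sigma> s t \<longleftrightarrow> tyof \<Gamma> s = Some \<sigma> \<and> tyof \<Gamma> t = Some \<sigma> \<and> (\<Gamma>; H \<turnstile> Eq \<sigma> s t)"

lemma deq_Eq: "deq \<Gamma> H \<sigma> s t \<Longrightarrow> \<Gamma>; H \<turnstile> Eq \<sigma> s t"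
  by (simp add: deq_def)

lemma deq_refl: "tyof \<Gamma> t = Some \<sigma> \<Longrightarrow> deq \<Gamma> H \<sigma> t t"
  by (simp add: deq_def HA_derivable HA_axiom.refl)

lemma deq_subst:
  assumes "deq \<Gamma> H \<sigma> s t" "tyof (\<sigma> # \<Gamma>) u = Some \<tau>"
  shows "deq \<Gamma> H \<tau> (tsub (inst s) u) (tsub (inst t) u)"
proof -
  have st: "tyof \<Gamma> s = Some \<sigma>" "tyof \<Gamma> t = Some \<sigma>" "\<Gamma>; H \<turnstile> Eq \<sigma> s t"
    using assms(1) by (simp_all add: deq_def)
  have ty: "tyof \<Gamma> (tsub (inst s) u) = Some \<tau>" "tyof \<Gamma> (tsub (inst t) u) = Some \<tau>"
    using st assms(2) tyof_tsub[OF typed_sub_inst] by blast+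
  \<comment> \<open>Leibniz for the formula whose left side is frozen at s by weakening: its
    instance at s is reflexivity, its instance at t is the claim.\<close>
  have "\<Gamma>; H \<turnstile> fsub (inst t) (Eq \<tau> (tsub wk (tsub (inst s) u)) u)"
    using ty deq_refl[OF ty(1), of H] assms(2)
    by (intro leibniz_subst[OF st(3,1,2)]) (simp_all add: deq_def)
  then show ?thesis using ty by (simp add: deq_def)
qed

lemma deq_sym: assumes "deq \<Gamma> H \<sigma> s t" shows "deq \<Gamma> H \<sigma> t s"
proof -
  have "\<Gamma>; H \<turnstile> fsub (inst t) (Eq \<sigma> (Var 0) (tsub wk s))"
    using assms deq_refl[of \<Gamma> s \<sigma> H]
    by (intro leibniz_subst[of \<Gamma> H \<sigma> s t]) (simp_all add: deq_def)
  then show ?thesis using assms by (simp add: deq_def)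
qed

lemma deq_trans [trans]: assumes "deq \<Gamma> H \<sigma> r s" "deq \<Gamma> H \<sigma> s t" shows "deq \<Gamma> H \<sigma> r t"
proof -
  have "\<Gamma>; H \<turnstile> fsub (inst t) (Eq \<sigma> (tsub wk r) (Var 0))"
    using assms by (intro leibniz_subst[of \<Gamma> H \<sigma> s t]) (simp_all add: deq_def)
  then show ?thesis using assms by (simp add: deq_def)
qed

lemma deq_app:
  assumes "deq \<Gamma> H (\<sigma> \<rightarrow> \<tau>) f g" "deq \<Gamma> H \<sigma> s t"
  shows "deq \<Gamma> H \<tau> (f \<cdot> s) (g \<cdot> t)"
proof -
  have ty: "tyof \<Gamma> f = Some (\<sigma> \<rightarrow> \<tau>)" "tyof \<Gamma> g = Some (\<sigma> \<rightarrow> \<tau>)" 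
      "tyof \<Gamma> s = Some \<sigma>" "tyof \<Gamma> t = Some \<sigma>"
    using assms by (simp_all add: deq_def)
  have "deq \<Gamma> H \<tau> (f \<cdot> s) (g \<cdot> s)"
    using deq_subst[OF assms(1), where u = "Var 0 \<cdot> tsub wk s" and \<tau> = \<tau>] ty by simp
  also have "deq \<Gamma> H \<tau> (g \<cdot> s) (g \<cdot> t)"
    using deq_subst[OF assms(2), where u = "tsub wk g \<cdot> Var 0" and \<tau> = \<tau>] ty by simp
  finally show ?thesis .
qed

lemma deq_app1:
  "deq \<Gamma> H (\<sigma> \<rightarrow> \<tau>) f g \<Longrightarrow> tyof \<Gamma> s = Some \<sigma> \<Longrightarrow> deq \<Gamma> H \<tau> (f \<cdot> s) (g \<cdot> s)"
  by (rule deq_app[OF _ deq_refl])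

lemma deq_app2:
  "deq \<Gamma> H \<sigma> s t \<Longrightarrow> tyof \<Gamma> f = Some (\<sigma> \<rightarrow> \<tau>) \<Longrightarrow> deq \<Gamma> H \<tau> (f \<cdot> s) (f \<cdot> t)"
  by (rule deq_app[OF deq_refl])

lemma deq_beta:
  assumes "tyof (\<sigma> # \<Gamma>) t = Some \<tau>" "tyof \<Gamma> s = Some \<sigma>"
  shows "deq \<Gamma> H \<tau> (Lam \<sigma> t \<cdot> s) (tsub (inst s) t)"
  using assms HA_derivable[OF HA_axiom.beta[of \<sigma> \<Gamma> t \<tau> s], of H]
  by (simp add: deq_def tyof_tsub[OF typed_sub_inst])

lemma deq_ext:
  assumes "deq (\<sigma> # \<Gamma>) (map (fsub wk) H) \<tau> (tsub wk f \<cdot> Var 0) (tsub wk g \<cdot> Var 0)"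
    and "tyof \<Gamma> f = Some (\<sigma> \<rightarrow> \<tau>)" "tyof \<Gamma> g = Some (\<sigma> \<rightarrow> \<tau>)"
  shows "deq \<Gamma> H (\<sigma> \<rightarrow> \<tau>) f g"
proof -
  have "\<Gamma>; H \<turnstile> Forall \<sigma> (Eq \<tau> (tsub wk f \<cdot> Var 0) (tsub wk g \<cdot> Var 0))"
    using assms(1) by (intro all_intro) (simp add: deq_def)
  moreover have "\<Gamma>; H \<turnstile> Imp (Forall \<sigma> (Eq \<tau> (tsub wk f \<cdot> Var 0) (tsub wk g \<cdot> Var 0)))
      (Eq (\<sigma> \<rightarrow> \<tau>) f g)"
    using HA_derivable[OF HA_axiom.ext[of \<Gamma> f \<sigma> \<tau> g], of H] assms by simp
  ultimately show ?thesis using assms ImpE unfolding deq_def by blast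
qed

section \<open>Induction rules and addition\<close>

abbreviation "Zero \<equiv> Con CZero"
abbreviation Succ :: "trm \<Rightarrow> trm" where "Succ n \<equiv> Con CSucc \<cdot> n"
abbreviation Empty :: "ty \<Rightarrow> trm" where "Empty X \<equiv> Con (CNil X)"
abbreviation Snoc :: "ty \<Rightarrow> trm \<Rightarrow> trm \<Rightarrow> trm" where "Snoc X s x \<equiv> Con (CSnoc X) \<cdot> s \<cdot> x"

lemma nat_induct_rule:
  assumes "wff (TN # \<Gamma>) A" "tyof \<Gamma> n = Some TN"
    and "\<Gamma>; H \<turnstile> fsub (inst Zero) A"
    and "TN # \<Gamma>; A # map (fsub wk) H \<turnstile> fsub (wkinst (Succ (Var 0))) A"
  shows "\<Gamma>; H \<turnstile> fsub (inst n) A"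
proof -
  have "\<Gamma>; H \<turnstile> Imp (fsub (inst Zero) A)
      (Imp (Forall TN (Imp A (fsub (wkinst (Succ (Var 0))) A))) (Forall TN A))"
    using HA_derivable[OF HA_axiom.induction[OF assms(1)], of H] by simp
  moreover have "\<Gamma>; H \<turnstile> Forall TN (Imp A (fsub (wkinst (Succ (Var 0))) A))"
    by (rule all_intro, rule ImpI[OF assms(4,1)])
  ultimately show ?thesis using assms(2,3) ImpE all_elim by blast
qed

lemma list_induct_rule:
  assumes "wff (TStar X # \<Gamma>) A" "tyof \<Gamma> s = Some (TStar X)"
    and "\<Gamma>; H \<turnstile> fsub (inst (Empty X)) A"
    and "X # TStar X # \<Gamma>; fsub wk A # map (fsub wk) (map (fsub wk) H)
        \<turnstile> fsub (wk2inst (Snoc X (Var 1) (Var 0))) A"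
  shows "\<Gamma>; H \<turnstile> fsub (inst s) A"
proof -
  \<comment> \<open>Under the binders for s and x, plugging \<open>Var 1\<close> for s merely lifts
    the formula past x.\<close>
  have [simp]: "fsub (wk2inst (Var (Suc 0))) A = fsub wk A"
  proof -
    have "wk2inst (Var (Suc 0)) = wk"
      by (auto simp: wk2inst_def wk_def split: nat.split)
    then show ?thesis by simp
  qed
  have "\<Gamma>; H \<turnstile> Imp (fsub (inst (Empty X)) A)
      (Imp (Forall (TStar X) (Forall X (Imp (fsub wk A)
        (fsub (wk2inst (Snoc X (Var 1) (Var 0))) A)))) (Forall (TStar X) A))"
    using HA_derivable[OF HA_axiom.list_induction[OF assms(1)], of H] by simp
  moreover have "\<Gamma>; H \<turnstile> Forall (TStar X) (Forall X (Imp (fsub wk A)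
        (fsub (wk2inst (Snoc X (Var 1) (Var 0))) A)))"
    using assms(1,4) by (intro all_intro ImpI) (simp_all add: wff_fsub[OF typed_sub_wk])
  ultimately show ?thesis using assms(2,3) ImpE all_elim by blast
qed

definition nplus :: "trm \<Rightarrow> trm \<Rightarrow> trm" where
  "nplus m k = Con (CRec TN) \<cdot> m \<cdot> Lam TN (Lam TN (Succ (Var 0))) \<cdot> k"

lemma tsub_nplus [simp]: "tsub f (nplus m k) = nplus (tsub f m) (tsub f k)"
  by (simp add: nplus_def)

lemma tyof_nplus [simp]:
  "tyof \<Gamma> m = Some TN \<Longrightarrow> tyof \<Gamma> k = Some TN \<Longrightarrow> tyof \<Gamma> (nplus m k) = Some TN"
  by (simp add: nplus_def)

lemma nplus_0: "tyof \<Gamma> m = Some TN \<Longrightarrow> deq \<Gamma> H TN (nplus m Zero) m"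
  by (simp add: deq_def nplus_def HA_derivable HA_axiom.rec_zero)

text \<open>The recursion axiom followed by both beta steps. The nested substitutions on the right
  are evaluated by the simplifier at each use.\<close>

lemma deq_rec_Suc:
  assumes "tyof \<Gamma> a = Some \<sigma>" "tyof (\<sigma> # TN # \<Gamma>) t = Some \<sigma>" "tyof \<Gamma> n = Some TN"
  shows "deq \<Gamma> H \<sigma> (Con (CRec \<sigma>) \<cdot> a \<cdot> Lam TN (Lam \<sigma> t) \<cdot> Succ n)
    (tsub (inst (Con (CRec \<sigma>) \<cdot> a \<cdot> Lam TN (Lam \<sigma> t) \<cdot> n)) (tsub (up (inst n)) t))"
proof -
  let ?f = "Lam TN (Lam \<sigma> t)"
  let ?r = "Con (CRec \<sigma>) \<cdot> a \<cdot> ?f \<cdot> n"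
  have r: "tyof \<Gamma> ?r = Some \<sigma>" using assms by simp
  have t: "tyof (\<sigma> # \<Gamma>) (tsub (up (inst n)) t) = Some \<sigma>"
    using assms by (intro tyof_tsub[OF typed_sub_up[OF typed_sub_inst]])
  have "deq \<Gamma> H \<sigma> (Con (CRec \<sigma>) \<cdot> a \<cdot> ?f \<cdot> Succ n) (?f \<cdot> n \<cdot> ?r)"
    using assms by (simp add: deq_def HA_derivable HA_axiom.rec_succ)
  also have "deq \<Gamma> H \<sigma> (?f \<cdot> n \<cdot> ?r) (Lam \<sigma> (tsub (up (inst n)) t) \<cdot> ?r)"
    using deq_beta[of TN \<Gamma> "Lam \<sigma> t" "\<sigma> \<rightarrow> \<sigma>" n H] assms r
    by (intro deq_app1[of _ _ \<sigma> \<sigma>]) simp_all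
  also have "deq \<Gamma> H \<sigma> (Lam \<sigma> (tsub (up (inst n)) t) \<cdot> ?r) (tsub (inst ?r) (tsub (up (inst n)) t))"
    by (rule deq_beta[OF t r])
  finally show ?thesis .
qed

lemma deq_lrec_Snoc:
  assumes "tyof \<Gamma> a = Some \<tau>" "tyof (\<tau> # X # TStar X # \<Gamma>) t = Some \<tau>"
    and "tyof \<Gamma> s = Some (TStar X)" "tyof \<Gamma> x = Some X"
  shows "deq \<Gamma> H \<tau> (Con (CLRec X \<tau>) \<cdot> a \<cdot> Lam (TStar X) (Lam X (Lam \<tau> t)) \<cdot> Snoc X s x)
    (tsub (inst (Con (CLRec X \<tau>) \<cdot> a \<cdot> Lam (TStar X) (Lam X (Lam \<tau> t)) \<cdot> s))
      (tsub (up (inst x)) (tsub (up (up (inst s))) t)))"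
proof -
  let ?f = "Lam (TStar X) (Lam X (Lam \<tau> t))"
  let ?r = "Con (CLRec X \<tau>) \<cdot> a \<cdot> ?f \<cdot> s"
  let ?t1 = "tsub (up (up (inst s))) t" and ?t2 = "tsub (up (inst x)) (tsub (up (up (inst s))) t)"
  have r: "tyof \<Gamma> ?r = Some \<tau>" using assms by simp
  have t1: "tyof (\<tau> # X # \<Gamma>) ?t1 = Some \<tau>"
    by (rule tyof_tsub[OF typed_sub_up[OF typed_sub_up[OF typed_sub_inst[OF assms(3)]]] assms(2)])
  have t2: "tyof (\<tau> # \<Gamma>) ?t2 = Some \<tau>"
    by (rule tyof_tsub[OF typed_sub_up[OF typed_sub_inst[OF assms(4)]] t1])
  have "deq \<Gamma> H \<tau> (Con (CLRec X \<tau>) \<cdot> a \<cdot> ?f \<cdot> Snoc X s x) (?f \<cdot> s \<cdot> x \<cdot> ?r)"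
    using assms by (simp add: deq_def HA_derivable HA_axiom.lrec_snoc)
  also have "deq \<Gamma> H \<tau> (?f \<cdot> s \<cdot> x \<cdot> ?r) (Lam X (Lam \<tau> ?t1) \<cdot> x \<cdot> ?r)"
    using deq_beta[of "TStar X" \<Gamma> "Lam X (Lam \<tau> t)" "X \<rightarrow> \<tau> \<rightarrow> \<tau>" s H] assms r
    by (intro deq_app1[of _ _ \<tau> \<tau>] deq_app1[of _ _ X]) simp_all
  also have "deq \<Gamma> H \<tau> (Lam X (Lam \<tau> ?t1) \<cdot> x \<cdot> ?r) (Lam \<tau> ?t2 \<cdot> ?r)"
    using deq_beta[of X \<Gamma> "Lam \<tau> ?t1" "\<tau> \<rightarrow> \<tau>" x H] assms r t1
    by (intro deq_app1[of _ _ \<tau> \<tau>]) simp_all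
  also have "deq \<Gamma> H \<tau> (Lam \<tau> ?t2 \<cdot> ?r) (tsub (inst ?r) ?t2)"
    by (rule deq_beta[OF t2 r])
  finally show ?thesis .
qed

lemma nplus_Suc:
  "tyof \<Gamma> m = Some TN \<Longrightarrow> tyof \<Gamma> k = Some TN \<Longrightarrow> deq \<Gamma> H TN (nplus m (Succ k)) (Succ (nplus m k))"
  using deq_rec_Suc[of \<Gamma> m TN "Succ (Var 0)" k H] by (simp add: nplus_def)

lemma deq_Succ: "deq \<Gamma> H TN m n \<Longrightarrow> deq \<Gamma> H TN (Succ m) (Succ n)"
  by (simp add: deq_app2)

lemma deq_nplus:
  "deq \<Gamma> H TN m m' \<Longrightarrow> deq \<Gamma> H TN k k' \<Longrightarrow> deq \<Gamma> H TN (nplus m k) (nplus m' k')"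
  unfolding nplus_def by (intro deq_app[of _ _ TN] deq_app2 deq_app1[of _ _ "TN \<rightarrow> TN \<rightarrow> TN"]) simp_all

lemma deq_hyp:
  "Eq \<sigma> s t \<in> set H \<Longrightarrow> tyof \<Gamma> s = Some \<sigma> \<Longrightarrow> tyof \<Gamma> t = Some \<sigma> \<Longrightarrow> deq \<Gamma> H \<sigma> s t"
  by (simp add: deq_def hyp)

text \<open>Addition recurses on its second argument, so this direction needs an induction. It moves
  a unit between the length of a prefix and the offset behind it.\<close>

lemma nplus_Suc_left:
  assumes "tyof \<Gamma> m = Some TN" "tyof \<Gamma> k = Some TN"
  shows "deq \<Gamma> H TN (nplus (Succ m) k) (Succ (nplus m k))"
proof -
  let ?A = "Eq TN (nplus (Succ (tsub wk m)) (Var 0)) (Succ (nplus (tsub wk m) (Var 0)))"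
  have "\<Gamma>; H \<turnstile> fsub (inst k) ?A"
  proof (rule nat_induct_rule)
    have "deq \<Gamma> H TN (nplus (Succ m) Zero) (Succ m)"
      using assms by (intro nplus_0) simp
    also have "deq \<Gamma> H TN (Succ m) (Succ (nplus m Zero))"
      using assms by (intro deq_sym[OF deq_Succ] nplus_0)
    finally show "\<Gamma>; H \<turnstile> fsub (inst Zero) ?A" by (simp add: deq_def)
  next
    let ?G = "TN # \<Gamma>" and ?H = "?A # map (fsub wk) H" and ?m = "tsub wk m"
    have "deq ?G ?H TN (nplus (Succ ?m) (Succ (Var 0))) (Succ (nplus (Succ ?m) (Var 0)))"
      using assms by (intro nplus_Suc) simp_all
    also have "deq ?G ?H TN \<dots> (Succ (Succ (nplus ?m (Var 0))))"
      using assms by (intro deq_Succ deq_hyp) simp_all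
    also have "deq ?G ?H TN \<dots> (Succ (nplus ?m (Succ (Var 0))))"
      using assms by (intro deq_Succ deq_sym[OF nplus_Suc]) simp_all
    finally show "?G; ?H \<turnstile> fsub (wkinst (Succ (Var 0))) ?A" by (simp add: deq_def)
  qed (use assms in simp_all)
  then show ?thesis using assms by (simp add: deq_def)
qed

lemma nplus_0_left:
  assumes "tyof \<Gamma> k = Some TN"
  shows "deq \<Gamma> H TN (nplus Zero k) k"
proof -
  let ?A = "Eq TN (nplus Zero (Var 0)) (Var 0)"
  have "\<Gamma>; H \<turnstile> fsub (inst k) ?A"
  proof (rule nat_induct_rule)
    show "\<Gamma>; H \<turnstile> fsub (inst Zero) ?A" using nplus_0[of \<Gamma> Zero H] by (simp add: deq_def)
  next
    let ?G = "TN # \<Gamma>" and ?H = "?A # map (fsub wk) H"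
    have "deq ?G ?H TN (nplus Zero (Succ (Var 0))) (Succ (nplus Zero (Var 0)))"
      by (intro nplus_Suc) simp_all
    also have "deq ?G ?H TN \<dots> (Succ (Var 0))"
      by (intro deq_Succ deq_hyp) simp_all
    finally show "?G; ?H \<turnstile> fsub (wkinst (Succ (Var 0))) ?A" by (simp add: deq_def)
  qed (use assms in simp_all)
  then show ?thesis using assms by (simp add: deq_def)
qed

text \<open>Replaces irreflexivity of an order on \<open>TN\<close>. Induction on n with k fixed:
  the step cancels one successor on both sides until zero equals a successor.\<close>

lemma not_eq_Suc_nplus:
  assumes "tyof \<Gamma> n = Some TN" "tyof \<Gamma> k = Some TN" and "deq \<Gamma> H TN n (nplus (Succ n) k)"
  shows "\<Gamma>; H \<turnstile> Bot"
proof -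
  let ?A = "Imp (Eq TN (Var 0) (nplus (Succ (Var 0)) (tsub wk k))) Bot"
  have "\<Gamma>; H \<turnstile> fsub (inst n) ?A"
  proof (rule nat_induct_rule)
    let ?H = "Eq TN Zero (nplus (Succ Zero) k) # H"
    have "deq \<Gamma> ?H TN (Succ (nplus Zero k)) (nplus (Succ Zero) k)"
      using assms by (intro deq_sym[OF nplus_Suc_left]) simp_all
    also have "deq \<Gamma> ?H TN \<dots> Zero"
      using assms by (intro deq_sym[OF deq_hyp]) simp_all
    finally have "\<Gamma>; ?H \<turnstile> Eq TN (Succ (nplus Zero k)) Zero" by (rule deq_Eq)
    then have "\<Gamma>; ?H \<turnstile> Bot"
      using assms by (intro ImpE[OF HA_derivable[OF HA_axiom.zero_not_succ]]) simp_all
    then show "\<Gamma>; H \<turnstile> fsub (inst Zero) ?A"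
      using assms by (simp add: ImpI)
  next
    let ?E = "Eq TN (Succ (Var 0)) (nplus (Succ (Succ (Var 0))) (tsub wk k))"
    let ?G = "TN # \<Gamma>" and ?H = "?E # ?A # map (fsub wk) H" and ?k = "tsub wk k"
    have "deq ?G ?H TN (Succ (Var 0)) (nplus (Succ (Succ (Var 0))) ?k)"
      using assms by (intro deq_hyp) simp_all
    also have "deq ?G ?H TN \<dots> (Succ (nplus (Succ (Var 0)) ?k))"
      using assms by (intro nplus_Suc_left) simp_all
    finally have "?G; ?H \<turnstile> Eq TN (Succ (Var 0)) (Succ (nplus (Succ (Var 0)) ?k))" by (rule deq_Eq)
    then have "?G; ?H \<turnstile> Eq TN (Var 0) (nplus (Succ (Var 0)) ?k)"
      by (rule ImpE[OF HA_derivable[OF HA_axiom.succ_inj], rotated 2]) (use assms in simp_all)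
    then have "?G; ?H \<turnstile> Bot"
      by (rule ImpE[OF hyp[of ?A], rotated]) simp
    then show "?G; ?A # map (fsub wk) H \<turnstile> fsub (wkinst (Succ (Var 0))) ?A"
      using assms by (simp add: ImpI)
  qed (use assms in simp_all)
  then show ?thesis using ImpE[OF _ deq_Eq[OF assms(3)]] by simp
qed

section \<open>Sequences and the functional ips\<close>

lemma tsub_initseg [simp]: "tsub f (initseg X \<alpha> n) = initseg X (tsub f \<alpha>) (tsub f n)"
  by (simp add: initseg_def)

lemma tyof_initseg [simp]:
  "tyof \<Gamma> \<alpha> = Some (TN \<rightarrow> X) \<Longrightarrow> tyof \<Gamma> n = Some TN \<Longrightarrow> tyof \<Gamma> (initseg X \<alpha> n) = Some (TStar X)"
  by (simp add: initseg_def)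

lemma initseg_0:
  "tyof \<Gamma> \<alpha> = Some (TN \<rightarrow> X) \<Longrightarrow> deq \<Gamma> H (TStar X) (initseg X \<alpha> Zero) (Empty X)"
  by (simp add: deq_def initseg_def HA_derivable HA_axiom.rec_zero)

lemma initseg_Suc:
  "tyof \<Gamma> \<alpha> = Some (TN \<rightarrow> X) \<Longrightarrow> tyof \<Gamma> n = Some TN \<Longrightarrow>
   deq \<Gamma> H (TStar X) (initseg X \<alpha> (Succ n)) (Snoc X (initseg X \<alpha> n) (\<alpha> \<cdot> n))"
  using deq_rec_Suc[of \<Gamma> "Empty X" "TStar X" "Snoc X (Var 0) (tsub wk (tsub wk \<alpha>) \<cdot> Var 1)" n H]
  by (simp add: initseg_def)

lemma deq_initseg:
  assumes "deq \<Gamma> H TN m n" "tyof \<Gamma> \<alpha> = Some (TN \<rightarrow> X)"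
  shows "deq \<Gamma> H (TStar X) (initseg X \<alpha> m) (initseg X \<alpha> n)"
  using deq_subst[OF assms(1), of "initseg X (tsub wk \<alpha>) (Var 0)" "TStar X"] assms(2) by simp

lemma tsub_seq_cons [simp]: "tsub f (seq_cons X x \<alpha>) = seq_cons X (tsub f x) (tsub f \<alpha>)"
  by (simp add: seq_cons_def)

lemma tyof_seq_cons [simp]:
  "tyof \<Gamma> x = Some X \<Longrightarrow> tyof \<Gamma> \<alpha> = Some (TN \<rightarrow> X) \<Longrightarrow> tyof \<Gamma> (seq_cons X x \<alpha>) = Some (TN \<rightarrow> X)"
  by (simp add: seq_cons_def)

lemma seq_cons_0:
  "tyof \<Gamma> x = Some X \<Longrightarrow> tyof \<Gamma> \<alpha> = Some (TN \<rightarrow> X) \<Longrightarrow> deq \<Gamma> H X (seq_cons X x \<alpha> \<cdot> Zero) x"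
  by (simp add: deq_def seq_cons_def HA_derivable HA_axiom.rec_zero)

lemma seq_cons_Suc:
  "tyof \<Gamma> x = Some X \<Longrightarrow> tyof \<Gamma> \<alpha> = Some (TN \<rightarrow> X) \<Longrightarrow> tyof \<Gamma> n = Some TN \<Longrightarrow>
   deq \<Gamma> H X (seq_cons X x \<alpha> \<cdot> Succ n) (\<alpha> \<cdot> n)"
  using deq_rec_Suc[of \<Gamma> x X "tsub wk (tsub wk \<alpha>) \<cdot> Var 1" n H]
  by (simp add: seq_cons_def)

lemma tsub_fun_cons [simp]: "tsub f (fun_cons X q x) = fun_cons X (tsub f q) (tsub f x)"
  by (simp add: fun_cons_def)

lemma tyof_fun_cons [simp]:
  "tyof \<Gamma> q = Some ((TN \<rightarrow> X) \<rightarrow> Y) \<Longrightarrow> tyof \<Gamma> x = Some X \<Longrightarrow>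
   tyof \<Gamma> (fun_cons X q x) = Some ((TN \<rightarrow> X) \<rightarrow> Y)"
  by (simp add: fun_cons_def)

lemma fun_cons_app:
  "tyof \<Gamma> q = Some ((TN \<rightarrow> X) \<rightarrow> Y) \<Longrightarrow> tyof \<Gamma> x = Some X \<Longrightarrow> tyof \<Gamma> \<alpha> = Some (TN \<rightarrow> X) \<Longrightarrow>
   deq \<Gamma> H Y (fun_cons X q x \<cdot> \<alpha>) (q \<cdot> seq_cons X x \<alpha>)"
  using deq_beta[of "TN \<rightarrow> X" \<Gamma> "tsub wk q \<cdot> seq_cons X (tsub wk x) (Var 0)" Y \<alpha> H]
  by (simp add: fun_cons_def)

abbreviation sel_ty :: "ty \<Rightarrow> ty \<Rightarrow> ty" where "sel_ty X Y \<equiv> TN \<rightarrow> (X \<rightarrow> Y) \<rightarrow> X"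

lemma tsub_ips [simp]: "tsub f (ips X Y n \<epsilon> q) = ips X Y (tsub f n) (tsub f \<epsilon>) (tsub f q)"
  by (simp add: ips_def)

lemma tyof_ips [simp]:
  "tyof \<Gamma> n = Some TN \<Longrightarrow> tyof \<Gamma> \<epsilon> = Some (sel_ty X Y) \<Longrightarrow>
   tyof \<Gamma> q = Some ((TN \<rightarrow> X) \<rightarrow> Y) \<Longrightarrow> tyof \<Gamma> (ips X Y n \<epsilon> q) = Some (TN \<rightarrow> X)"
  by (simp add: ips_def)

lemma deq_ips:
  "deq \<Gamma> H TN m n \<Longrightarrow> deq \<Gamma> H ((TN \<rightarrow> X) \<rightarrow> Y) p q \<Longrightarrow> tyof \<Gamma> \<epsilon> = Some (sel_ty X Y) \<Longrightarrow>
   deq \<Gamma> H (TN \<rightarrow> X) (ips X Y m \<epsilon> p) (ips X Y n \<epsilon> q)"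
  unfolding ips_def
  by (rule deq_app, rule deq_app1[of _ _ "sel_ty X Y"], rule deq_app2) simp_all

text \<open>The continuation handed to the selection function, separated from the call so that it
  can be shown to realize A(n) -> R on its own.\<close>

definition ips_arg :: "ty \<Rightarrow> ty \<Rightarrow> trm \<Rightarrow> trm \<Rightarrow> trm \<Rightarrow> trm" where
  "ips_arg X Y n \<epsilon> q = Lam X (fun_cons X (tsub wk q) (Var 0)
     \<cdot> ips X Y (Succ (tsub wk n)) (tsub wk \<epsilon>) (fun_cons X (tsub wk q) (Var 0)))"

lemma ips_head_eq: "ips_head X Y n \<epsilon> q = \<epsilon> \<cdot> n \<cdot> ips_arg X Y n \<epsilon> q"
  by (simp add: ips_head_def ips_arg_def)

lemma tsub_ips_arg [simp]: "tsub f (ips_arg X Y n \<epsilon> q) = ips_arg X Y (tsub f n) (tsub f \<epsilon>) (tsub f q)"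
  by (simp add: ips_arg_def)

lemma tyof_ips_arg [simp]:
  "tyof \<Gamma> n = Some TN \<Longrightarrow> tyof \<Gamma> \<epsilon> = Some (sel_ty X Y) \<Longrightarrow>
   tyof \<Gamma> q = Some ((TN \<rightarrow> X) \<rightarrow> Y) \<Longrightarrow> tyof \<Gamma> (ips_arg X Y n \<epsilon> q) = Some (X \<rightarrow> Y)"
  by (simp add: ips_arg_def tyof_fun_cons[where Y = Y])

lemma tsub_ips_head [simp]:
  "tsub f (ips_head X Y n \<epsilon> q) = ips_head X Y (tsub f n) (tsub f \<epsilon>) (tsub f q)"
  by (simp add: ips_head_eq)

lemma tyof_ips_head [simp]:
  "tyof \<Gamma> n = Some TN \<Longrightarrow> tyof \<Gamma> \<epsilon> = Some (sel_ty X Y) \<Longrightarrow>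
   tyof \<Gamma> q = Some ((TN \<rightarrow> X) \<rightarrow> Y) \<Longrightarrow> tyof \<Gamma> (ips_head X Y n \<epsilon> q) = Some X"
  by (simp add: ips_head_eq)

lemma ips_arg_app:
  "tyof \<Gamma> n = Some TN \<Longrightarrow> tyof \<Gamma> \<epsilon> = Some (sel_ty X Y) \<Longrightarrow>
   tyof \<Gamma> q = Some ((TN \<rightarrow> X) \<rightarrow> Y) \<Longrightarrow> tyof \<Gamma> x = Some X \<Longrightarrow>
   deq \<Gamma> H Y (ips_arg X Y n \<epsilon> q \<cdot> x) (fun_cons X q x \<cdot> ips X Y (Succ n) \<epsilon> (fun_cons X q x))"
  using deq_beta[of X \<Gamma> "fun_cons X (tsub wk q) (Var 0)
     \<cdot> ips X Y (Succ (tsub wk n)) (tsub wk \<epsilon>) (fun_cons X (tsub wk q) (Var 0))" Y x H]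
  by (simp add: ips_arg_def tyof_fun_cons[where Y = Y])

text \<open>The only appeal to the \<open>ips\<close> axiom, and with \<open>CONT_elim\<close> one
  of the two places where discreteness of Y is consumed.\<close>

lemma ips_unfold:
  assumes "discrete_ty Y"
    and "tyof \<Gamma> n = Some TN" "tyof \<Gamma> \<epsilon> = Some (sel_ty X Y)" "tyof \<Gamma> q = Some ((TN \<rightarrow> X) \<rightarrow> Y)"
  shows "deq \<Gamma> H (TN \<rightarrow> X) (ips X Y n \<epsilon> q)
    (seq_cons X (ips_head X Y n \<epsilon> q)
      (ips X Y (Succ n) \<epsilon> (fun_cons X q (ips_head X Y n \<epsilon> q))))"
proof -
  have "\<Gamma>; H \<turnstile> ips_equation X Y" by (intro ax theory_axiom.ips assms)
  from all_elim[OF all_elim[OF all_elim[OF this[unfolded ips_equation_def Let_def] assms(2), simplified],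
        OF assms(3), simplified], OF assms(4)]
  show ?thesis using assms by (simp add: deq_def)
qed

lemma ips_0:
  assumes "discrete_ty Y"
    and "tyof \<Gamma> n = Some TN" "tyof \<Gamma> \<epsilon> = Some (sel_ty X Y)" "tyof \<Gamma> q = Some ((TN \<rightarrow> X) \<rightarrow> Y)"
  shows "deq \<Gamma> H X (ips X Y n \<epsilon> q \<cdot> Zero) (ips_head X Y n \<epsilon> q)"
  by (rule deq_trans[OF deq_app1[OF ips_unfold] seq_cons_0]) (use assms in simp_all)

lemma ips_Suc:
  assumes "discrete_ty Y"
    and "tyof \<Gamma> n = Some TN" "tyof \<Gamma> \<epsilon> = Some (sel_ty X Y)" "tyof \<Gamma> q = Some ((TN \<rightarrow> X) \<rightarrow> Y)"
    and "tyof \<Gamma> i = Some TN"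
  shows "deq \<Gamma> H X (ips X Y n \<epsilon> q \<cdot> Succ i)
    (ips X Y (Succ n) \<epsilon> (fun_cons X q (ips_head X Y n \<epsilon> q)) \<cdot> i)"
  by (rule deq_trans[OF deq_app1[OF ips_unfold] seq_cons_Suc]) (use assms in simp_all)

section \<open>Length of finite sequences and concatenation with a tail\<close>

definition len :: "ty \<Rightarrow> trm \<Rightarrow> trm" where
  "len X s = Con (CLRec X TN) \<cdot> Zero \<cdot> Lam (TStar X) (Lam X (Lam TN (Succ (Var 0)))) \<cdot> s"

text \<open>The recursion produces a function of the tail: removing the last entry x of the finite
  sequence has to push x onto the tail, so the tail changes from one stage to the next.\<close>

definition prepend :: "ty \<Rightarrow> trm \<Rightarrow> trm \<Rightarrow> trm" where
  "prepend X s \<beta> = Con (CLRec X ((TN \<rightarrow> X) \<rightarrow> TN \<rightarrow> X)) \<cdot> Lam (TN \<rightarrow> X) (Var 0)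
     \<cdot> Lam (TStar X) (Lam X (Lam ((TN \<rightarrow> X) \<rightarrow> TN \<rightarrow> X)
         (Lam (TN \<rightarrow> X) (Var 1 \<cdot> seq_cons X (Var 2) (Var 0))))) \<cdot> s \<cdot> \<beta>"

lemma tsub_len [simp]: "tsub f (len X s) = len X (tsub f s)"
  by (simp add: len_def)

lemma tyof_len [simp]: "tyof \<Gamma> s = Some (TStar X) \<Longrightarrow> tyof \<Gamma> (len X s) = Some TN"
  by (simp add: len_def)

lemma len_Empty: "deq \<Gamma> H TN (len X (Empty X)) Zero"
  by (simp add: deq_def len_def HA_derivable HA_axiom.lrec_nil)

lemma len_Snoc:
  "tyof \<Gamma> s = Some (TStar X) \<Longrightarrow> tyof \<Gamma> x = Some X \<Longrightarrow>
   deq \<Gamma> H TN (len X (Snoc X s x)) (Succ (len X s))"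
  using deq_lrec_Snoc[of \<Gamma> Zero TN X "Succ (Var 0)" s x H] by (simp add: len_def)

lemma deq_len: "deq \<Gamma> H (TStar X) s t \<Longrightarrow> deq \<Gamma> H TN (len X s) (len X t)"
  unfolding len_def by (rule deq_app2) simp_all

lemma tsub_prepend [simp]: "tsub f (prepend X s \<beta>) = prepend X (tsub f s) (tsub f \<beta>)"
  by (simp add: prepend_def)

lemma tyof_prepend [simp]:
  "tyof \<Gamma> s = Some (TStar X) \<Longrightarrow> tyof \<Gamma> \<beta> = Some (TN \<rightarrow> X) \<Longrightarrow> tyof \<Gamma> (prepend X s \<beta>) = Some (TN \<rightarrow> X)"
  by (simp add: prepend_def)

lemma prepend_Empty:
  assumes "tyof \<Gamma> \<beta> = Some (TN \<rightarrow> X)"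
  shows "deq \<Gamma> H (TN \<rightarrow> X) (prepend X (Empty X) \<beta>) \<beta>"
proof -
  have "deq \<Gamma> H (TN \<rightarrow> X) (prepend X (Empty X) \<beta>) (Lam (TN \<rightarrow> X) (Var 0) \<cdot> \<beta>)"
    unfolding prepend_def using assms
    by (intro deq_app1[of _ _ "TN \<rightarrow> X"]) (simp_all add: deq_def HA_derivable HA_axiom.lrec_nil)
  also have "deq \<Gamma> H (TN \<rightarrow> X) \<dots> \<beta>"
    using deq_beta[of "TN \<rightarrow> X" \<Gamma> "Var 0" "TN \<rightarrow> X" \<beta> H] assms by simp
  finally show ?thesis .
qed

lemma prepend_Snoc:
  assumes "tyof \<Gamma> s = Some (TStar X)" "tyof \<Gamma> x = Some X" "tyof \<Gamma> \<beta> = Some (TN \<rightarrow> X)"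
  shows "deq \<Gamma> H (TN \<rightarrow> X) (prepend X (Snoc X s x) \<beta>) (prepend X s (seq_cons X x \<beta>))"
proof -
  let ?T = "(TN \<rightarrow> X) \<rightarrow> TN \<rightarrow> X"
  let ?r = "Con (CLRec X ?T) \<cdot> Lam (TN \<rightarrow> X) (Var 0)
     \<cdot> Lam (TStar X) (Lam X (Lam ?T (Lam (TN \<rightarrow> X) (Var 1 \<cdot> seq_cons X (Var 2) (Var 0)))))"
  have "deq \<Gamma> H (TN \<rightarrow> X) (prepend X (Snoc X s x) \<beta>)
      (Lam (TN \<rightarrow> X) (tsub wk (?r \<cdot> s) \<cdot> seq_cons X (tsub wk x) (Var 0)) \<cdot> \<beta>)"
    unfolding prepend_def
    using deq_lrec_Snoc[of \<Gamma> "Lam (TN \<rightarrow> X) (Var 0)" ?T X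
        "Lam (TN \<rightarrow> X) (Var 1 \<cdot> seq_cons X (Var 2) (Var 0))" s x H] assms
    by (intro deq_app1[of _ _ "TN \<rightarrow> X"]) simp_all
  also have "deq \<Gamma> H (TN \<rightarrow> X) \<dots> (?r \<cdot> s \<cdot> seq_cons X x \<beta>)"
    using deq_beta[of "TN \<rightarrow> X" \<Gamma> "tsub wk (?r \<cdot> s) \<cdot> seq_cons X (tsub wk x) (Var 0)" "TN \<rightarrow> X" \<beta> H]
      assms by simp
  finally show ?thesis by (simp add: prepend_def)
qed

lemma deq_prepend:
  "deq \<Gamma> H (TStar X) s t \<Longrightarrow> deq \<Gamma> H (TN \<rightarrow> X) \<alpha> \<beta> \<Longrightarrow>
   deq \<Gamma> H (TN \<rightarrow> X) (prepend X s \<alpha>) (prepend X t \<beta>)"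
  unfolding prepend_def by (rule deq_app, rule deq_app2) simp_all

text \<open>Both the tail and the offset vary in the list induction, since dropping the last entry x
  turns them into \<open>seq_cons X x \<beta>\<close> and \<open>Succ k\<close>.\<close>

lemma prepend_len_nplus:
  assumes "tyof \<Gamma> s = Some (TStar X)" "tyof \<Gamma> \<beta> = Some (TN \<rightarrow> X)" "tyof \<Gamma> k = Some TN"
  shows "deq \<Gamma> H X (prepend X s \<beta> \<cdot> nplus (len X s) k) (\<beta> \<cdot> k)"
proof -
  let ?A = "Forall (TN \<rightarrow> X) (Forall TN
    (Eq X (prepend X (Var 2) (Var 1) \<cdot> nplus (len X (Var 2)) (Var 0)) (Var 1 \<cdot> Var 0)))"
  have "\<Gamma>; H \<turnstile> fsub (inst s) ?A"
  proof (rule list_induct_rule)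
    let ?G = "TN # (TN \<rightarrow> X) # \<Gamma>" and ?H = "map (fsub wk) (map (fsub wk) H)"
    have "deq ?G ?H X (prepend X (Empty X) (Var 1) \<cdot> nplus (len X (Empty X)) (Var 0))
        (Var 1 \<cdot> nplus Zero (Var 0))"
      by (intro deq_app[of _ _ TN] prepend_Empty deq_nplus len_Empty deq_refl) simp_all
    also have "deq ?G ?H X \<dots> (Var 1 \<cdot> Var 0)"
      by (rule deq_app2[OF nplus_0_left]) simp_all
    finally show "\<Gamma>; H \<turnstile> fsub (inst (Empty X)) ?A"
      by (simp add: deq_def all_intro)
  next
    \<comment> \<open>The induction hypothesis as it reads in the context \<open>?G\<close>: s is
      \<open>Var 3\<close> there, hence \<open>Var 5\<close> below two quantifiers.\<close>
    let ?B = "Forall (TN \<rightarrow> X) (Forall TN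
      (Eq X (prepend X (Var 5) (Var 1) \<cdot> nplus (len X (Var 5)) (Var 0)) (Var 1 \<cdot> Var 0)))"
    let ?G = "TN # (TN \<rightarrow> X) # X # TStar X # \<Gamma>"
    let ?H = "map (fsub wk) (map (fsub wk) (fsub wk ?A # map (fsub wk) (map (fsub wk) H)))"
    let ?s = "Var 3" and ?x = "Var 2" and ?b = "Var 1" and ?k = "Var 0"
    have IH: "deq ?G ?H X (prepend X ?s (seq_cons X ?x ?b) \<cdot> nplus (len X ?s) (Succ ?k))
      (seq_cons X ?x ?b \<cdot> Succ ?k)"
    proof -
      have "?G; ?H \<turnstile> ?B" by (rule hyp) simp
      from all_elim[OF all_elim[OF this, of "seq_cons X ?x ?b", simplified], of "Succ ?k"]
      show ?thesis by (simp add: deq_def)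
    qed
    have "deq ?G ?H TN (nplus (len X (Snoc X ?s ?x)) ?k) (nplus (Succ (len X ?s)) ?k)"
      by (intro deq_nplus len_Snoc deq_refl) simp_all
    also have "deq ?G ?H TN \<dots> (Succ (nplus (len X ?s) ?k))"
      by (rule nplus_Suc_left) simp_all
    also have "deq ?G ?H TN \<dots> (nplus (len X ?s) (Succ ?k))"
      by (rule deq_sym[OF nplus_Suc]) simp_all
    finally have "deq ?G ?H X (prepend X (Snoc X ?s ?x) ?b \<cdot> nplus (len X (Snoc X ?s ?x)) ?k)
        (prepend X ?s (seq_cons X ?x ?b) \<cdot> nplus (len X ?s) (Succ ?k))"
      by (intro deq_app[of _ _ TN] prepend_Snoc) simp_all
    also note IH
    also have "deq ?G ?H X (seq_cons X ?x ?b \<cdot> Succ ?k) (?b \<cdot> ?k)"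
      by (rule seq_cons_Suc) simp_all
    finally show "X # TStar X # \<Gamma>; fsub wk ?A # map (fsub wk) (map (fsub wk) H)
        \<turnstile> fsub (wk2inst (Snoc X (Var 1) (Var 0))) ?A"
      by (simp add: deq_def all_intro)
  qed (use assms in simp_all)
  from all_elim[OF all_elim[OF this[simplified] assms(2), simplified], OF assms(3)]
  show ?thesis using assms by (simp add: deq_def)
qed

lemma prepend_len:
  assumes "tyof \<Gamma> s = Some (TStar X)" "tyof \<Gamma> \<beta> = Some (TN \<rightarrow> X)"
  shows "deq \<Gamma> H X (prepend X s \<beta> \<cdot> len X s) (\<beta> \<cdot> Zero)"
proof -
  have "deq \<Gamma> H X (prepend X s \<beta> \<cdot> len X s) (prepend X s \<beta> \<cdot> nplus (len X s) Zero)"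
    using assms by (intro deq_app2[of _ _ TN] deq_sym[OF nplus_0]) simp_all
  also have "deq \<Gamma> H X \<dots> (\<beta> \<cdot> Zero)"
    by (rule prepend_len_nplus) (use assms in simp_all)
  finally show ?thesis .
qed

text \<open>Supplies the premise of \<open>CONT\<close>: every continuation of s passes through the
  node s. The step uses the hypothesis with x already moved onto the tail.\<close>

lemma initseg_prepend:
  assumes "tyof \<Gamma> s = Some (TStar X)" "tyof \<Gamma> \<beta> = Some (TN \<rightarrow> X)"
  shows "deq \<Gamma> H (TStar X) (initseg X (prepend X s \<beta>) (len X s)) s"
proof -
  let ?A = "Forall (TN \<rightarrow> X) (Eq (TStar X) (initseg X (prepend X (Var 1) (Var 0)) (len X (Var 1))) (Var 1))"
  have "\<Gamma>; H \<turnstile> fsub (inst s) ?A"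
  proof (rule list_induct_rule)
    let ?G = "(TN \<rightarrow> X) # \<Gamma>" and ?H = "map (fsub wk) H"
    have "deq ?G ?H (TStar X) (initseg X (prepend X (Empty X) (Var 0)) (len X (Empty X)))
        (initseg X (prepend X (Empty X) (Var 0)) Zero)"
      by (rule deq_initseg[OF len_Empty]) simp
    also have "deq ?G ?H (TStar X) \<dots> (Empty X)"
      by (rule initseg_0) simp
    finally show "\<Gamma>; H \<turnstile> fsub (inst (Empty X)) ?A"
      by (simp add: deq_def all_intro)
  next
    let ?B = "Forall (TN \<rightarrow> X) (Eq (TStar X) (initseg X (prepend X (Var 3) (Var 0)) (len X (Var 3))) (Var 3))"
    let ?G = "(TN \<rightarrow> X) # X # TStar X # \<Gamma>"
    let ?H = "map (fsub wk) (fsub wk ?A # map (fsub wk) (map (fsub wk) H))"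
    let ?s = "Var 2" and ?x = "Var 1" and ?b = "Var 0"
    let ?c = "seq_cons X ?x ?b"
    have IH: "deq ?G ?H (TStar X) (initseg X (prepend X ?s ?c) (len X ?s)) ?s"
    proof -
      have "?G; ?H \<turnstile> ?B" by (rule hyp) simp
      from all_elim[OF this, of ?c] show ?thesis by (simp add: deq_def)
    qed
    have x: "deq ?G ?H X (prepend X ?s ?c \<cdot> len X ?s) ?x"
      by (rule deq_trans[OF prepend_len seq_cons_0]) simp_all
    have "deq ?G ?H (TStar X) (initseg X (prepend X (Snoc X ?s ?x) ?b) (len X (Snoc X ?s ?x)))
        (initseg X (prepend X (Snoc X ?s ?x) ?b) (Succ (len X ?s)))"
      by (intro deq_initseg len_Snoc) simp_all
    \<comment> \<open>\<open>deq_initseg\<close> rewrites the length only, so the sequence argument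
      is rewritten by \<open>deq_subst\<close>; \<open>Var 3\<close> is s lifted past the
      placeholder.\<close>
    also have "deq ?G ?H (TStar X) \<dots> (initseg X (prepend X ?s ?c) (Succ (len X ?s)))"
      using deq_subst[OF prepend_Snoc, of ?G ?s X ?x ?b "initseg X (Var 0) (Succ (len X (Var 3)))" "TStar X" ?H]
      by simp
    also have "deq ?G ?H (TStar X) \<dots> (Snoc X (initseg X (prepend X ?s ?c) (len X ?s)) (prepend X ?s ?c \<cdot> len X ?s))"
      by (rule initseg_Suc) simp_all
    also have "deq ?G ?H (TStar X) \<dots> (Snoc X ?s ?x)"
      by (rule deq_app[OF deq_app2[OF IH] x]) simp_all
    finally show "X # TStar X # \<Gamma>; fsub wk ?A # map (fsub wk) (map (fsub wk) H)
        \<turnstile> fsub (wk2inst (Snoc X (Var 1) (Var 0))) ?A"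
      by (simp add: deq_def all_intro)
  qed (use assms in simp_all)
  from all_elim[OF this[simplified] assms(2)] show ?thesis using assms by (simp add: deq_def)
qed

lemma len_initseg:
  assumes "tyof \<Gamma> \<alpha> = Some (TN \<rightarrow> X)" "tyof \<Gamma> n = Some TN"
  shows "deq \<Gamma> H TN (len X (initseg X \<alpha> n)) n"
proof -
  let ?A = "Eq TN (len X (initseg X (tsub wk \<alpha>) (Var 0))) (Var 0)"
  have "\<Gamma>; H \<turnstile> fsub (inst n) ?A"
  proof (rule nat_induct_rule)
    have "deq \<Gamma> H TN (len X (initseg X \<alpha> Zero)) (len X (Empty X))"
      using assms by (intro deq_len initseg_0)
    also have "deq \<Gamma> H TN \<dots> Zero" by (rule len_Empty)
    finally show "\<Gamma>; H \<turnstile> fsub (inst Zero) ?A" by (simp add: deq_def)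
  next
    let ?G = "TN # \<Gamma>" and ?H = "?A # map (fsub wk) H" and ?\<alpha> = "tsub wk \<alpha>"
    have "deq ?G ?H TN (len X (initseg X ?\<alpha> (Succ (Var 0))))
        (len X (Snoc X (initseg X ?\<alpha> (Var 0)) (?\<alpha> \<cdot> Var 0)))"
      using assms by (intro deq_len initseg_Suc) simp_all
    also have "deq ?G ?H TN \<dots> (Succ (len X (initseg X ?\<alpha> (Var 0))))"
      using assms by (intro len_Snoc) simp_all
    also have "deq ?G ?H TN \<dots> (Succ (Var 0))"
      using assms by (intro deq_Succ deq_hyp) simp_all
    finally show "?G; ?H \<turnstile> fsub (wkinst (Succ (Var 0))) ?A" by (simp add: deq_def)
  qed (use assms in simp_all)
  then show ?thesis using assms by (simp add: deq_def)
qed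

section \<open>Realizers under constant outcome\<close>

text \<open>Many later lemmas ask for members of H instead of derivable formulas, because
  \<open>all_intro\<close> and \<open>ex_elim\<close> lift H along with the context. A cut turns a
  derived formula into such a member.\<close>

lemma cut: "\<Gamma>; H \<turnstile> A \<Longrightarrow> \<Gamma>; A # H \<turnstile> B \<Longrightarrow> wff \<Gamma> A \<Longrightarrow> \<Gamma>; H \<turnstile> B"
  by (rule ImpE[OF ImpI])

lemma wff_up_wk [simp]: "wff (\<sigma> # \<Gamma>) A \<Longrightarrow> wff (\<sigma> # \<rho> # \<Gamma>) (fsub (up wk) A)"
  by (erule wff_fsub[rotated]) simp

lemma wff_up_up_wk [simp]:
  "wff (\<sigma> # \<tau> # \<Gamma>) A \<Longrightarrow> wff (\<sigma> # \<tau> # \<rho> # \<Gamma>) (fsub (up (up wk)) A)"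
  by (erule wff_fsub[rotated]) simp

text \<open>Weakening of a predicate: the context grows beneath its two arguments, or its one
  argument, which stay in place.\<close>

abbreviation "wk_at2 \<equiv> fsub (up (up wk))"
abbreviation "wk_at1 \<equiv> fsub (up wk)"

text \<open>
  The realizability predicates enter only through formulas \<open>M\<close> over \<open>X # TN # \<Gamma>\<close> and \<open>Q\<close> over
  \<open>Y # \<Gamma>\<close>: \<open>at2 M x n\<close> stands for ``\<open>x\<close> realizes \<open>A(n)\<close>'' and \<open>at1 Q r\<close> for ``\<open>r\<close> realizes \<open>R\<close>''.
\<close>

definition at2 :: "fm \<Rightarrow> trm \<Rightarrow> trm \<Rightarrow> fm" where
  "at2 M x n = fsub (inst x) (fsub (up (inst n)) M)"

definition at1 :: "fm \<Rightarrow> trm \<Rightarrow> fm" where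
  "at1 Q r = fsub (inst r) Q"

lemma fsub_at1 [simp]: "fsub f (at1 Q r) = at1 (fsub (up f) Q) (tsub f r)"
  unfolding at1_def by (rule fsub_inst)

lemma fsub_at2 [simp]: "fsub f (at2 M x n) = at2 (fsub (up (up f)) M) (tsub f x) (tsub f n)"
proof -
  have "(\<lambda>i. tsub f (inst n i)) = (\<lambda>i. tsub (inst (tsub f n)) (up f i))"
  proof
    fix i show "tsub f (inst n i) = tsub (inst (tsub f n)) (up f i)"
      by (cases i) simp_all
  qed
  then have "fsub (up f) (fsub (up (inst n)) M) = fsub (up (inst (tsub f n))) (fsub (up (up f)) M)"
    by (simp add: fsub_fsub up_tsub)
  then show ?thesis unfolding at2_def by (simp add: fsub_inst[of f])
qed

lemma wff_at2 [simp]: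
  assumes "tyof \<Gamma> x = Some X" "tyof \<Gamma> n = Some TN" "wff (X # TN # \<Gamma>) M"
  shows "wff \<Gamma> (at2 M x n)"
  unfolding at2_def
  by (rule wff_fsub[OF typed_sub_inst[OF assms(1)] wff_fsub[OF typed_sub_up[OF typed_sub_inst[OF assms(2)]] assms(3)]])

lemma wff_at1 [simp]: "tyof \<Gamma> r = Some Y \<Longrightarrow> wff (Y # \<Gamma>) Q \<Longrightarrow> wff \<Gamma> (at1 Q r)"
  unfolding at1_def by (rule wff_fsub[OF typed_sub_inst])

lemma at1_cong:
  assumes "deq \<Gamma> H Y r s" "wff (Y # \<Gamma>) Q" "\<Gamma>; H \<turnstile> at1 Q r"
  shows "\<Gamma>; H \<turnstile> at1 Q s"
  using leibniz_subst[of \<Gamma> H Y r s Q] assms by (simp add: at1_def deq_def)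

lemma at2_cong:
  assumes "deq \<Gamma> H X x y" "deq \<Gamma> H TN m n" "wff (X # TN # \<Gamma>) M" "\<Gamma>; H \<turnstile> at2 M x m"
  shows "\<Gamma>; H \<turnstile> at2 M y n"
proof -
  have ty: "tyof \<Gamma> x = Some X" "tyof \<Gamma> y = Some X" "tyof \<Gamma> m = Some TN" "tyof \<Gamma> n = Some TN"
    "\<Gamma>; H \<turnstile> Eq X x y" "\<Gamma>; H \<turnstile> Eq TN m n"
    using assms(1,2) by (simp_all add: deq_def)
  \<comment> \<open>Two Leibniz steps, first for the value and then for the index, each with the
    other argument frozen by weakening.\<close>
  have "\<Gamma>; H \<turnstile> at2 M y m"
    using leibniz_subst[of \<Gamma> H X x y "at2 (wk_at2 M) (Var 0) (tsub wk m)"] ty assms(3,4)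
    by simp
  then show ?thesis
    using leibniz_subst[of \<Gamma> H TN m n "at2 (wk_at2 M) (tsub wk y) (Var 0)"] ty assms(3)
    by simp
qed

lemma at2_cong1:
  assumes "deq \<Gamma> H X x y" "tyof \<Gamma> n = Some TN" "wff (X # TN # \<Gamma>) M" "\<Gamma>; H \<turnstile> at2 M x n"
  shows "\<Gamma>; H \<turnstile> at2 M y n"
  using at2_cong[OF assms(1) deq_refl[OF assms(2)] assms(3,4)] .

text \<open>Has exactly the shape to which \<open>mr\<close> unfolds for the premise of the shift,
  so that \<open>mr_eq_sel_hyp\<close> is a plain equality of formulas. The same holds for
  \<open>outcome_hyp\<close>.\<close>

definition sel_hyp :: "ty \<Rightarrow> ty \<Rightarrow> fm \<Rightarrow> fm \<Rightarrow> trm \<Rightarrow> fm" where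
  "sel_hyp X Y M Q \<epsilon> = Forall TN (Forall (X \<rightarrow> Y)
     (Imp (Forall X (Imp (at2 (wk_at2 (wk_at2 (wk_at2 M))) (Var 0) (Var 2)) (at1 (wk_at1 (wk_at1 (wk_at1 Q))) (Var 1 \<cdot> Var 0))))
       (at2 (wk_at2 (wk_at2 M)) (tsub wk (tsub wk \<epsilon>) \<cdot> Var 1 \<cdot> Var 0) (Var 1))))"

definition outcome_hyp :: "ty \<Rightarrow> fm \<Rightarrow> fm \<Rightarrow> trm \<Rightarrow> fm" where
  "outcome_hyp X M Q q = Forall (TN \<rightarrow> X)
     (Imp (Forall TN (at2 (wk_at2 (wk_at2 M)) (Var 1 \<cdot> Var 0) (Var 0))) (at1 (wk_at1 Q) (tsub wk q \<cdot> Var 0)))"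

lemma fsub_sel_hyp [simp]: "fsub f (sel_hyp X Y M Q \<epsilon>) = sel_hyp X Y (fsub (up (up f)) M) (fsub (up f) Q) (tsub f \<epsilon>)"
  by (simp add: sel_hyp_def)

lemma fsub_outcome_hyp [simp]: "fsub f (outcome_hyp X M Q q) = outcome_hyp X (fsub (up (up f)) M) (fsub (up f) Q) (tsub f q)"
  by (simp add: outcome_hyp_def)

lemma sel_hyp_elim:
  assumes "\<Gamma>; H \<turnstile> sel_hyp X Y M Q \<epsilon>" "tyof \<Gamma> n = Some TN" "tyof \<Gamma> g = Some (X \<rightarrow> Y)"
    and "wff (X # TN # \<Gamma>) M"
    and "X # \<Gamma>; at2 (wk_at2 M) (Var 0) (tsub wk n) # map (fsub wk) H \<turnstile> at1 (wk_at1 Q) (tsub wk g \<cdot> Var 0)"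
  shows "\<Gamma>; H \<turnstile> at2 M (\<epsilon> \<cdot> n \<cdot> g) n"
proof -
  have "\<Gamma>; H \<turnstile> Imp (Forall X (Imp (at2 (wk_at2 M) (Var 0) (tsub wk n)) (at1 (wk_at1 Q) (tsub wk g \<cdot> Var 0))))
      (at2 M (\<epsilon> \<cdot> n \<cdot> g) n)"
    using all_elim[OF all_elim[OF assms(1)[unfolded sel_hyp_def] assms(2), simplified] assms(3)] by simp
  moreover have "X # \<Gamma>; map (fsub wk) H \<turnstile> Imp (at2 (wk_at2 M) (Var 0) (tsub wk n)) (at1 (wk_at1 Q) (tsub wk g \<cdot> Var 0))"
    using assms by (intro ImpI) simp_all
  ultimately show ?thesis using ImpE all_intro by blast
qed

lemma outcome_hyp_elim:
  assumes "\<Gamma>; H \<turnstile> outcome_hyp X M Q q" "tyof \<Gamma> \<alpha> = Some (TN \<rightarrow> X)"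
    and "TN # \<Gamma>; map (fsub wk) H \<turnstile> at2 (wk_at2 M) (tsub wk \<alpha> \<cdot> Var 0) (Var 0)"
  shows "\<Gamma>; H \<turnstile> at1 Q (q \<cdot> \<alpha>)"
proof -
  have "\<Gamma>; H \<turnstile> Imp (Forall TN (at2 (wk_at2 M) (tsub wk \<alpha> \<cdot> Var 0) (Var 0))) (at1 Q (q \<cdot> \<alpha>))"
    using all_elim[OF assms(1)[unfolded outcome_hyp_def] assms(2)] by simp
  then show ?thesis using ImpE all_intro[OF assms(3)] by blast
qed

text \<open>The consequence of constancy that the argument works with: values of q realize R
  whatever the argument. Unlike \<open>outcome_hyp\<close> it passes from q to
  \<open>fun_cons X q x\<close> for arbitrary x.\<close>

definition outcome_all :: "ty \<Rightarrow> fm \<Rightarrow> trm \<Rightarrow> fm" where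
  "outcome_all X Q q = Forall (TN \<rightarrow> X) (at1 (wk_at1 Q) (tsub wk q \<cdot> Var 0))"

lemma fsub_outcome_all [simp]: "fsub f (outcome_all X Q q) = outcome_all X (fsub (up f) Q) (tsub f q)"
  by (simp add: outcome_all_def)

lemma wff_outcome_all: "tyof \<Gamma> q = Some ((TN \<rightarrow> X) \<rightarrow> Y) \<Longrightarrow> wff (Y # \<Gamma>) Q \<Longrightarrow> wff \<Gamma> (outcome_all X Q q)"
  by (simp add: outcome_all_def)

text \<open>The continuation returns values of q only, and these all realize R; hence it realizes
  A(n) -> R and \<epsilon> answers it correctly.\<close>

lemma const_head:
  assumes "sel_hyp X Y M Q \<epsilon> \<in> set H" "wff (X # TN # \<Gamma>) M" "wff (Y # \<Gamma>) Q"
    and "tyof \<Gamma> \<epsilon> = Some (sel_ty X Y)" "tyof \<Gamma> n = Some TN" "tyof \<Gamma> q = Some ((TN \<rightarrow> X) \<rightarrow> Y)"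
    and "outcome_all X Q q \<in> set H"
  shows "\<Gamma>; H \<turnstile> at2 M (ips_head X Y n \<epsilon> q) n"
  unfolding ips_head_eq
proof (rule sel_hyp_elim[OF hyp[OF assms(1)] assms(5)])
  let ?G = "X # \<Gamma>" and ?H = "at2 (wk_at2 M) (Var 0) (tsub wk n) # map (fsub wk) H"
  let ?q = "tsub wk q" and ?\<epsilon> = "tsub wk \<epsilon>" and ?n = "tsub wk n"
  let ?\<beta> = "ips X Y (Succ ?n) ?\<epsilon> (fun_cons X ?q (Var 0))"
  have "?G; ?H \<turnstile> outcome_all X (wk_at1 Q) ?q"
    using hyp_wk[OF assms(7)] by (intro hyp) simp
  from all_elim[OF this[unfolded outcome_all_def], of "seq_cons X (Var 0) ?\<beta>"]
  have *: "?G; ?H \<turnstile> at1 (wk_at1 Q) (?q \<cdot> seq_cons X (Var 0) ?\<beta>)" using assms by simp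
  have "deq ?G ?H Y (tsub wk (ips_arg X Y n \<epsilon> q) \<cdot> Var 0) (fun_cons X ?q (Var 0) \<cdot> ?\<beta>)"
    using ips_arg_app[of ?G ?n ?\<epsilon> X Y ?q "Var 0" ?H] assms by simp
  also have "deq ?G ?H Y \<dots> (?q \<cdot> seq_cons X (Var 0) ?\<beta>)"
    using assms by (intro fun_cons_app) simp_all
  finally show "?G; ?H \<turnstile> at1 (wk_at1 Q) (tsub wk (ips_arg X Y n \<epsilon> q) \<cdot> Var 0)"
    by (rule at1_cong[OF deq_sym _ *]) (use assms in simp)
qed (use assms in simp_all)

lemma outcome_all_fun_cons:
  assumes "outcome_all X Q q \<in> set H" "wff (Y # \<Gamma>) Q" 
    and "tyof \<Gamma> q = Some ((TN \<rightarrow> X) \<rightarrow> Y)" "tyof \<Gamma> x = Some X"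
  shows "\<Gamma>; H \<turnstile> outcome_all X Q (fun_cons X q x)"
  unfolding outcome_all_def
proof (rule all_intro)
  let ?G = "(TN \<rightarrow> X) # \<Gamma>" and ?H = "map (fsub wk) H"
  let ?q = "tsub wk q" and ?\<beta> = "seq_cons X (tsub wk x) (Var 0)"
  have "?G; ?H \<turnstile> outcome_all X (wk_at1 Q) ?q"
    using hyp_wk[OF assms(1)] by (intro hyp) simp
  from all_elim[OF this[unfolded outcome_all_def], of ?\<beta>]
  have *: "?G; ?H \<turnstile> at1 (wk_at1 Q) (?q \<cdot> ?\<beta>)" using assms by simp
  have "deq ?G ?H Y (tsub wk (fun_cons X q x) \<cdot> Var 0) (?q \<cdot> ?\<beta>)"
    using fun_cons_app[of ?G ?q X Y "tsub wk x" "Var 0" ?H] assms by simp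
  then show "?G; ?H \<turnstile> at1 (wk_at1 Q) (tsub wk (fun_cons X q x) \<cdot> Var 0)"
    by (rule at1_cong[OF deq_sym _ *]) (use assms in simp)
qed

text \<open>The outcome function is generalized in the induction, since it becomes \<open>q\<^sub>c\<close> in the tail.\<close>

lemma const_ips:
  assumes "sel_hyp X Y M Q \<epsilon> \<in> set H" "wff (X # TN # \<Gamma>) M" "wff (Y # \<Gamma>) Q" "discrete_ty Y"
    and "tyof \<Gamma> \<epsilon> = Some (sel_ty X Y)" "tyof \<Gamma> n = Some TN" "tyof \<Gamma> q = Some ((TN \<rightarrow> X) \<rightarrow> Y)"
    and "tyof \<Gamma> i = Some TN"
    and "outcome_all X Q q \<in> set H"
  shows "\<Gamma>; H \<turnstile> at2 M (ips X Y n \<epsilon> q \<cdot> i) (nplus n i)"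
proof -
  \<comment> \<open>The stage n is generalized as well: entry i + 1 at stage n is entry i at stage n
    + 1.\<close>
  let ?A = "Forall TN (Forall ((TN \<rightarrow> X) \<rightarrow> Y) (Imp (outcome_all X (wk_at1 (wk_at1 (wk_at1 Q))) (Var 0))
    (at2 (wk_at2 (wk_at2 (wk_at2 M))) (ips X Y (Var 1) (tsub wk (tsub wk (tsub wk \<epsilon>))) (Var 0) \<cdot> Var 2)
      (nplus (Var 1) (Var 2)))))"
  have "\<Gamma>; H \<turnstile> fsub (inst i) ?A"
  proof (rule nat_induct_rule)
    show "wff (TN # \<Gamma>) ?A" using assms by (simp add: wff_outcome_all[of _ _ _ Y])
  next
    let ?G = "((TN \<rightarrow> X) \<rightarrow> Y) # TN # \<Gamma>"
    let ?H = "outcome_all X (wk_at1 (wk_at1 Q)) (Var 0) # map (fsub wk) (map (fsub wk) H)"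
    let ?M = "wk_at2 (wk_at2 M)" and ?\<epsilon> = "tsub wk (tsub wk \<epsilon>)"
    have *: "?G; ?H \<turnstile> at2 ?M (ips_head X Y (Var 1) ?\<epsilon> (Var 0)) (Var 1)"
    proof (rule const_head[where Q = "wk_at1 (wk_at1 Q)"])
      show "sel_hyp X Y ?M (wk_at1 (wk_at1 Q)) ?\<epsilon> \<in> set ?H"
        using hyp_wk[OF hyp_wk[OF assms(1)]] by simp
    qed (use assms in simp_all)
    have "?G; ?H \<turnstile> at2 ?M (ips X Y (Var 1) ?\<epsilon> (Var 0) \<cdot> Zero) (nplus (Var 1) Zero)"
      by (rule at2_cong[OF deq_sym[OF ips_0] deq_sym[OF nplus_0] _ *]) (use assms in simp_all)
    then have "?G; map (fsub wk) (map (fsub wk) H) \<turnstile> Imp (outcome_all X (wk_at1 (wk_at1 Q)) (Var 0))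
        (at2 ?M (ips X Y (Var 1) ?\<epsilon> (Var 0) \<cdot> Zero) (nplus (Var 1) Zero))"
      using assms by (intro ImpI) (simp_all add: wff_outcome_all[of _ _ _ Y])
    then show "\<Gamma>; H \<turnstile> fsub (inst Zero) ?A"
      by (simp add: all_intro)
  next
    let ?G = "((TN \<rightarrow> X) \<rightarrow> Y) # TN # TN # \<Gamma>"
    let ?K = "map (fsub wk) (map (fsub wk) (?A # map (fsub wk) H))"
    let ?M = "wk_at2 (wk_at2 (wk_at2 M))" and ?\<epsilon> = "tsub wk (tsub wk (tsub wk \<epsilon>))" and ?Q = "wk_at1 (wk_at1 (wk_at1 Q))"
    let ?H = "outcome_all X ?Q (Var 0) # ?K"
    let ?i = "Var 2" and ?n = "Var 1" and ?q = "Var 0"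
    let ?c = "ips_head X Y ?n ?\<epsilon> ?q"
    let ?B = "Forall TN (Forall ((TN \<rightarrow> X) \<rightarrow> Y) (Imp (outcome_all X (wk_at1 (wk_at1 ?Q)) (Var 0))
    (at2 (wk_at2 (wk_at2 ?M)) (ips X Y (Var 1) (tsub wk (tsub wk ?\<epsilon>)) (Var 0) \<cdot> Var 4)
      (nplus (Var 1) (Var 4)))))"
    have c: "tyof ?G ?c = Some X" using assms by simp
    have "?G; ?H \<turnstile> ?B" by (rule hyp) simp
    from all_elim[OF all_elim[OF this, of "Succ ?n", simplified], of "fun_cons X ?q ?c"] 
    have "?G; ?H \<turnstile> Imp (outcome_all X ?Q (fun_cons X ?q ?c))
       (at2 ?M (ips X Y (Succ ?n) ?\<epsilon> (fun_cons X ?q ?c) \<cdot> ?i) (nplus (Succ ?n) ?i))"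
      using c by simp
    moreover have "?G; ?H \<turnstile> outcome_all X ?Q (fun_cons X ?q ?c)"
      using assms c by (intro outcome_all_fun_cons[of _ _ _ _ Y]) simp_all
    ultimately have *: "?G; ?H \<turnstile> at2 ?M (ips X Y (Succ ?n) ?\<epsilon> (fun_cons X ?q ?c) \<cdot> ?i) (nplus (Succ ?n) ?i)"
      by (rule ImpE)
    \<comment> \<open>The hypothesis speaks of position (n + 1) + i, the goal of n + (i +
      1).\<close>
    have p: "deq ?G ?H TN (nplus (Succ ?n) ?i) (nplus ?n (Succ ?i))"
      by (rule deq_trans[OF nplus_Suc_left deq_sym[OF nplus_Suc]]) simp_all
    have "?G; ?H \<turnstile> at2 ?M (ips X Y ?n ?\<epsilon> ?q \<cdot> Succ ?i) (nplus ?n (Succ ?i))"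
      by (rule at2_cong[OF deq_sym[OF ips_Suc] p _ *]) (use assms in simp_all)
    then have "?G; ?K \<turnstile> Imp (outcome_all X ?Q ?q) (at2 ?M (ips X Y ?n ?\<epsilon> ?q \<cdot> Succ ?i) (nplus ?n (Succ ?i)))"
      using assms by (intro ImpI) (simp_all add: wff_outcome_all[of _ _ _ Y])
    then show "TN # \<Gamma>; ?A # map (fsub wk) H \<turnstile> fsub (wkinst (Succ (Var 0))) ?A"
      by (simp add: all_intro)
  qed (use assms in simp_all)
  from ImpE[OF all_elim[OF all_elim[OF this[simplified] assms(6), simplified] assms(7), simplified]
      hyp[OF assms(9)]]
  show ?thesis .
qed

section \<open>The predicates of the bar induction\<close>

lemma ImpE2: "\<Gamma>; H \<turnstile> Imp A (Imp B C) \<Longrightarrow> \<Gamma>; H \<turnstile> A \<Longrightarrow> \<Gamma>; H \<turnstile> B \<Longrightarrow> \<Gamma>; H \<turnstile> C"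
  by (rule ImpE[OF ImpE])

text \<open>The function q_s for an object-level sequence s. In the bar induction s is a variable,
  so an iteration of \<open>fun_cons\<close> along a fixed list would not do.\<close>

definition q_after :: "ty \<Rightarrow> trm \<Rightarrow> trm \<Rightarrow> trm" where
  "q_after X q s = Lam (TN \<rightarrow> X) (tsub wk q \<cdot> prepend X (tsub wk s) (Var 0))"

lemma tsub_q_after [simp]: "tsub f (q_after X q s) = q_after X (tsub f q) (tsub f s)"
  by (simp add: q_after_def)

lemma tyof_q_after [simp]:
  "tyof \<Gamma> q = Some ((TN \<rightarrow> X) \<rightarrow> Y) \<Longrightarrow> tyof \<Gamma> s = Some (TStar X) \<Longrightarrow>
   tyof \<Gamma> (q_after X q s) = Some ((TN \<rightarrow> X) \<rightarrow> Y)"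
  by (simp add: q_after_def)

lemma q_after_app:
  "tyof \<Gamma> q = Some ((TN \<rightarrow> X) \<rightarrow> Y) \<Longrightarrow> tyof \<Gamma> s = Some (TStar X) \<Longrightarrow> tyof \<Gamma> \<beta> = Some (TN \<rightarrow> X) \<Longrightarrow>
   deq \<Gamma> H Y (q_after X q s \<cdot> \<beta>) (q \<cdot> prepend X s \<beta>)"
  using deq_beta[of "TN \<rightarrow> X" \<Gamma> "tsub wk q \<cdot> prepend X (tsub wk s) (Var 0)" Y \<beta> H]
  by (simp add: q_after_def)

lemma q_after_Empty:
  assumes "tyof \<Gamma> q = Some ((TN \<rightarrow> X) \<rightarrow> Y)"
  shows "deq \<Gamma> H ((TN \<rightarrow> X) \<rightarrow> Y) (q_after X q (Empty X)) q"
proof (rule deq_ext)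
  let ?G = "(TN \<rightarrow> X) # \<Gamma>" and ?H = "map (fsub wk) H" and ?q = "tsub wk q"
  have "deq ?G ?H Y (q_after X ?q (Empty X) \<cdot> Var 0) (?q \<cdot> prepend X (Empty X) (Var 0))"
    using assms by (intro q_after_app) simp_all
  also have "deq ?G ?H Y \<dots> (?q \<cdot> Var 0)"
    by (rule deq_app2[OF prepend_Empty]) (use assms in simp_all)
  finally show "deq ?G ?H Y (tsub wk (q_after X q (Empty X)) \<cdot> Var 0) (?q \<cdot> Var 0)" by simp
qed (use assms in simp_all)

text \<open>Extensionality is essential: the two functions are compared on every tail, but
  \<open>ips\<close> receives the function itself as an argument.\<close>

lemma q_after_Snoc:
  assumes "tyof \<Gamma> q = Some ((TN \<rightarrow> X) \<rightarrow> Y)" "tyof \<Gamma> s = Some (TStar X)" "tyof \<Gamma> x = Some X"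
  shows "deq \<Gamma> H ((TN \<rightarrow> X) \<rightarrow> Y) (q_after X q (Snoc X s x)) (fun_cons X (q_after X q s) x)"
proof (rule deq_ext)
  let ?G = "(TN \<rightarrow> X) # \<Gamma>" and ?H = "map (fsub wk) H"
  let ?q = "tsub wk q" and ?s = "tsub wk s" and ?x = "tsub wk x"
  have "deq ?G ?H Y (q_after X ?q (Snoc X ?s ?x) \<cdot> Var 0) (?q \<cdot> prepend X (Snoc X ?s ?x) (Var 0))"
    using assms by (intro q_after_app) simp_all
  also have "deq ?G ?H Y \<dots> (?q \<cdot> prepend X ?s (seq_cons X ?x (Var 0)))"
    by (rule deq_app2[OF prepend_Snoc]) (use assms in simp_all)
  also have "deq ?G ?H Y \<dots> (q_after X ?q ?s \<cdot> seq_cons X ?x (Var 0))"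
    using assms by (intro deq_sym[OF q_after_app]) simp_all
  also have "deq ?G ?H Y \<dots> (fun_cons X (q_after X ?q ?s) ?x \<cdot> Var 0)"
    using assms by (intro deq_sym[OF fun_cons_app]) simp_all
  finally show "deq ?G ?H Y (tsub wk (q_after X q (Snoc X s x)) \<cdot> Var 0)
      (tsub wk (fun_cons X (q_after X q s) x) \<cdot> Var 0)" by simp
qed (use assms in simp_all)

text \<open>
  \<open>beyond X s i\<close> says that \<open>i = |s| + k\<close> for some \<open>k\<close>, and \<open>correct_seq\<close> says of every \<open>i\<close> not beyond
  \<open>s\<close> that entry \<open>i\<close> of \<open>s * \<beta>\<close> is correct. Stating this as a disjunction for all \<open>\<beta>\<close> avoids both
  an order on \<open>TN\<close> and a default element of \<open>X\<close>.
\<close>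

definition beyond :: "ty \<Rightarrow> trm \<Rightarrow> trm \<Rightarrow> fm" where
  "beyond X s i = Exists TN (Eq TN (tsub wk i) (nplus (len X (tsub wk s)) (Var 0)))"

definition correct_seq :: "ty \<Rightarrow> fm \<Rightarrow> trm \<Rightarrow> fm" where
  "correct_seq X M s = Forall TN (Forall (TN \<rightarrow> X) (Or (beyond X (tsub wk (tsub wk s)) (Var 1))
     (at2 (wk_at2 (wk_at2 M)) (prepend X (tsub wk (tsub wk s)) (Var 0) \<cdot> Var 1) (Var 1))))"

definition correct_ips :: "ty \<Rightarrow> ty \<Rightarrow> fm \<Rightarrow> trm \<Rightarrow> trm \<Rightarrow> trm \<Rightarrow> fm" where
  "correct_ips X Y M \<epsilon> q s = Forall TN (at2 (wk_at2 M) (tsub wk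
     (prepend X s (ips X Y (len X s) \<epsilon> (q_after X q s))) \<cdot> Var 0) (Var 0))"

lemma fsub_beyond [simp]: "fsub f (beyond X s i) = beyond X (tsub f s) (tsub f i)"
  by (simp add: beyond_def)

lemma fsub_correct_seq [simp]: "fsub f (correct_seq X M s) = correct_seq X (fsub (up (up f)) M) (tsub f s)"
  by (simp add: correct_seq_def)

lemma fsub_correct_ips [simp]:
  "fsub f (correct_ips X Y M \<epsilon> q s) = correct_ips X Y (fsub (up (up f)) M) (tsub f \<epsilon>) (tsub f q) (tsub f s)"
  by (simp add: correct_ips_def)

lemma wff_beyond [simp]:
  "tyof \<Gamma> s = Some (TStar X) \<Longrightarrow> tyof \<Gamma> i = Some TN \<Longrightarrow> wff \<Gamma> (beyond X s i)"
  by (simp add: beyond_def)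

lemma wff_correct_seq [simp]: "tyof \<Gamma> s = Some (TStar X) \<Longrightarrow> wff (X # TN # \<Gamma>) M \<Longrightarrow> wff \<Gamma> (correct_seq X M s)"
  by (simp add: correct_seq_def)

lemma wff_correct_ips [simp]:
  "tyof \<Gamma> s = Some (TStar X) \<Longrightarrow> wff (X # TN # \<Gamma>) M \<Longrightarrow> tyof \<Gamma> \<epsilon> = Some (sel_ty X Y) \<Longrightarrow>
   tyof \<Gamma> q = Some ((TN \<rightarrow> X) \<rightarrow> Y) \<Longrightarrow> wff \<Gamma> (correct_ips X Y M \<epsilon> q s)"
  by (simp add: correct_ips_def)

section \<open>Correct prefixes: empty sequence, limit, extension, completion by a tail\<close>

lemma beyond_intro:
  assumes "deq \<Gamma> H TN i (nplus (len X s) k)" "tyof \<Gamma> s = Some (TStar X)" "tyof \<Gamma> k = Some TN"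
  shows "\<Gamma>; H \<turnstile> beyond X s i"
  unfolding beyond_def
  by (rule ex_intro[of _ _ k]) (use assms in \<open>simp_all add: deq_def\<close>)

lemma correct_seq_intro:
  assumes "(TN \<rightarrow> X) # TN # \<Gamma>; map (fsub wk) (map (fsub wk) H)
    \<turnstile> Or (beyond X (tsub wk (tsub wk s)) (Var 1))
        (at2 (wk_at2 (wk_at2 M)) (prepend X (tsub wk (tsub wk s)) (Var 0) \<cdot> Var 1) (Var 1))"
  shows "\<Gamma>; H \<turnstile> correct_seq X M s"
  unfolding correct_seq_def by (intro all_intro assms)

lemma correct_seq_elim:
  assumes "\<Gamma>; H \<turnstile> correct_seq X M s" "tyof \<Gamma> i = Some TN" "tyof \<Gamma> \<beta> = Some (TN \<rightarrow> X)"
  shows "\<Gamma>; H \<turnstile> Or (beyond X s i) (at2 M (prepend X s \<beta> \<cdot> i) i)"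
  using all_elim[OF all_elim[OF assms(1)[unfolded correct_seq_def] assms(2), simplified] assms(3)] by simp

text \<open>Every position i lies beyond the empty sequence, with i itself as offset.\<close>

lemma correct_seq_Empty:
  assumes "wff (X # TN # \<Gamma>) M"
  shows "\<Gamma>; H \<turnstile> correct_seq X M (Empty X)"
proof (intro correct_seq_intro OrI1)
  let ?G = "(TN \<rightarrow> X) # TN # \<Gamma>" and ?H = "map (fsub wk) (map (fsub wk) H)"
  have "deq ?G ?H TN (nplus (len X (Empty X)) (Var 1)) (nplus Zero (Var 1))"
    by (intro deq_nplus len_Empty deq_refl) simp
  also have "deq ?G ?H TN \<dots> (Var 1)"
    by (rule nplus_0_left) simp
  finally show "?G; ?H \<turnstile> beyond X (tsub wk (tsub wk (Empty X))) (Var 1)"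
    using beyond_intro[OF deq_sym] by simp
qed (use assms in simp_all)

text \<open>The segment of length i + 1 is the first one to contain position i; if i lay beyond it,
  then i = (i + 1) + k, which \<open>not_eq_Suc_nplus\<close> refutes.\<close>

lemma correct_seq_limit:
  assumes "\<Gamma>; H \<turnstile> Forall TN (correct_seq X (wk_at2 M) (initseg X (tsub wk \<alpha>) (Var 0)))"
    and "wff (X # TN # \<Gamma>) M" "tyof \<Gamma> \<alpha> = Some (TN \<rightarrow> X)" "tyof \<Gamma> i = Some TN"
  shows "\<Gamma>; H \<turnstile> at2 M (\<alpha> \<cdot> i) i"
proof (rule OrE)
  let ?s = "initseg X \<alpha> (Succ i)"
  have "\<Gamma>; H \<turnstile> correct_seq X M ?s"
    using all_elim[OF assms(1), of "Succ i"] assms by simp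
  then show "\<Gamma>; H \<turnstile> Or (beyond X ?s i) (at2 M (prepend X ?s \<alpha> \<cdot> i) i)"
    using assms by (intro correct_seq_elim)
  show "\<Gamma>; beyond X ?s i # H \<turnstile> at2 M (\<alpha> \<cdot> i) i"
  proof (rule ex_elim[OF hyp[of "beyond X ?s i", unfolded beyond_def]])
    let ?G = "TN # \<Gamma>" and ?i = "tsub wk i"
    let ?H = "Eq TN ?i (nplus (len X (tsub wk ?s)) (Var 0)) # map (fsub wk) (beyond X ?s i # H)"
    have "deq ?G ?H TN ?i (nplus (len X (tsub wk ?s)) (Var 0))"
      using assms by (intro deq_hyp) simp_all
    also have "deq ?G ?H TN \<dots> (nplus (Succ ?i) (Var 0))"
      using assms len_initseg[of ?G "tsub wk \<alpha>" X "Succ ?i" ?H] by (intro deq_nplus deq_refl) simp_all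
    finally have "?G; ?H \<turnstile> Bot"
      using assms by (intro not_eq_Suc_nplus[of _ ?i "Var 0"]) simp_all
    then show "?G; ?H \<turnstile> fsub wk (at2 M (\<alpha> \<cdot> i) i)"
      by (rule BotE) (use assms in simp)
  qed (simp add: beyond_def)
  \<comment> \<open>The tail is \<alpha> itself. Splitting off the last entry of the segment puts
    \<alpha>(i) at the head of the new tail, directly behind a prefix of length i.\<close>
  let ?H = "at2 M (prepend X ?s \<alpha> \<cdot> i) i # H" and ?c = "seq_cons X (\<alpha> \<cdot> i) \<alpha>" and ?t = "initseg X \<alpha> i"
  have "deq \<Gamma> ?H X (prepend X ?s \<alpha> \<cdot> i) (prepend X (Snoc X ?t (\<alpha> \<cdot> i)) \<alpha> \<cdot> i)"
    using assms by (intro deq_app1[of _ _ TN] deq_prepend initseg_Suc deq_refl) simp_all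
  also have "deq \<Gamma> ?H X \<dots> (prepend X ?t ?c \<cdot> i)"
    using assms by (intro deq_app1[of _ _ TN] prepend_Snoc) simp_all
  also have "deq \<Gamma> ?H X \<dots> (prepend X ?t ?c \<cdot> len X ?t)"
    using assms by (intro deq_app2[of _ _ TN] deq_sym[OF len_initseg]) simp_all
  also have "deq \<Gamma> ?H X \<dots> (?c \<cdot> Zero)"
    using assms by (intro prepend_len) simp_all
  also have "deq \<Gamma> ?H X \<dots> (\<alpha> \<cdot> i)"
    using assms by (intro seq_cons_0) simp_all
  finally show "\<Gamma>; ?H \<turnstile> at2 M (\<alpha> \<cdot> i) i"
    by (rule at2_cong1[OF _ _ _ hyp]) (use assms in simp_all)
qed

text \<open>For i = |s| + k, induction on k serves as a case distinction: k = 0 is the position of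
  the new entry x, and a successor lies beyond \<open>Snoc X s x\<close>.\<close>

lemma correct_seq_Snoc_aux:
  assumes "at2 M x (len X s) \<in> set H"
    and "wff (X # TN # \<Gamma>) M" "tyof \<Gamma> s = Some (TStar X)" "tyof \<Gamma> x = Some X"
    and "tyof \<Gamma> i = Some TN" "tyof \<Gamma> \<beta> = Some (TN \<rightarrow> X)" "tyof \<Gamma> k = Some TN"
    and "Eq TN i (nplus (len X s) k) \<in> set H"
  shows "\<Gamma>; H \<turnstile> Or (beyond X (Snoc X s x) i) (at2 M (prepend X (Snoc X s x) \<beta> \<cdot> i) i)"
proof -
  let ?C = "Or (beyond X (Snoc X s x) i) (at2 M (prepend X (Snoc X s x) \<beta> \<cdot> i) i)"
  \<comment> \<open>The equation for i is a premise of the induction formula because it changes with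
    k.\<close>
  let ?A = "Imp (Eq TN (tsub wk i) (nplus (len X (tsub wk s)) (Var 0))) (fsub wk ?C)"
  have "\<Gamma>; H \<turnstile> fsub (inst k) ?A"
  proof (rule nat_induct_rule)
    let ?H = "Eq TN i (nplus (len X s) Zero) # H"
    have i: "deq \<Gamma> ?H TN (len X s) i"
      by (rule deq_sym[OF deq_trans[OF deq_hyp nplus_0]]) (use assms in simp_all)
    have "deq \<Gamma> ?H X (prepend X (Snoc X s x) \<beta> \<cdot> i) (prepend X s (seq_cons X x \<beta>) \<cdot> len X s)"
      using assms by (intro deq_app[of _ _ TN] prepend_Snoc deq_sym[OF i]) simp_all
    also have "deq \<Gamma> ?H X \<dots> (seq_cons X x \<beta> \<cdot> Zero)"
      using assms by (intro prepend_len) simp_all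
    also have "deq \<Gamma> ?H X \<dots> x"
      using assms by (intro seq_cons_0) simp_all
    finally have x: "deq \<Gamma> ?H X (prepend X (Snoc X s x) \<beta> \<cdot> i) x" .
    have "\<Gamma>; ?H \<turnstile> at2 M (prepend X (Snoc X s x) \<beta> \<cdot> i) i"
      by (rule at2_cong[OF deq_sym[OF x] i assms(2) hyp]) (use assms in simp)
    then have "\<Gamma>; ?H \<turnstile> ?C" by (rule OrI2) (use assms in simp)
    then have "\<Gamma>; H \<turnstile> Imp (Eq TN i (nplus (len X s) Zero)) ?C" by (rule ImpI) (use assms in simp)
    then show "\<Gamma>; H \<turnstile> fsub (inst Zero) ?A" by simp
  next
    let ?s = "tsub wk s" and ?x = "tsub wk x" and ?i = "tsub wk i" and ?G = "TN # \<Gamma>"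
    let ?E = "Eq TN ?i (nplus (len X ?s) (Succ (Var 0)))"
    let ?H = "?E # ?A # map (fsub wk) H"
    have "deq ?G ?H TN ?i (nplus (len X ?s) (Succ (Var 0)))"
      using assms by (intro deq_hyp) simp_all
    also have "deq ?G ?H TN \<dots> (Succ (nplus (len X ?s) (Var 0)))"
      using assms by (intro nplus_Suc) simp_all
    also have "deq ?G ?H TN \<dots> (nplus (Succ (len X ?s)) (Var 0))"
      using assms by (intro deq_sym[OF nplus_Suc_left]) simp_all
    also have "deq ?G ?H TN \<dots> (nplus (len X (Snoc X ?s ?x)) (Var 0))"
      using assms by (intro deq_nplus deq_sym[OF len_Snoc] deq_refl) simp_all
    finally have "?G; ?H \<turnstile> beyond X (Snoc X ?s ?x) ?i"
      by (rule beyond_intro) (use assms in simp_all)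
    then have "?G; ?H \<turnstile> fsub wk ?C" using assms by (simp add: OrI1)
    then have "?G; ?A # map (fsub wk) H \<turnstile> Imp ?E (fsub wk ?C)" by (rule ImpI) (use assms in simp)
    then show "?G; ?A # map (fsub wk) H \<turnstile> fsub (wkinst (Succ (Var 0))) ?A" by simp
  qed (use assms in simp_all)
  then have "\<Gamma>; H \<turnstile> Imp (Eq TN i (nplus (len X s) k)) ?C" by simp
  then show ?thesis using hyp[OF assms(8)] by (rule ImpE)
qed

text \<open>\<open>correct_seq\<close> for s is used with the tail x * \<beta>: the concatenated
  sequence is the same, so an entry correct there is correct here. Positions beyond s go to
  \<open>correct_seq_Snoc_aux\<close>.\<close>

lemma correct_seq_Snoc_inst:
  assumes "correct_seq X M s \<in> set H" "at2 M x (len X s) \<in> set H"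
    and "wff (X # TN # \<Gamma>) M" "tyof \<Gamma> s = Some (TStar X)" "tyof \<Gamma> x = Some X"
    and "tyof \<Gamma> i = Some TN" "tyof \<Gamma> \<beta> = Some (TN \<rightarrow> X)"
  shows "\<Gamma>; H \<turnstile> Or (beyond X (Snoc X s x) i) (at2 M (prepend X (Snoc X s x) \<beta> \<cdot> i) i)"
proof (rule OrE)
  let ?c = "seq_cons X x \<beta>"
  show "\<Gamma>; H \<turnstile> Or (beyond X s i) (at2 M (prepend X s ?c \<cdot> i) i)"
    using assms by (intro correct_seq_elim hyp) simp_all
  show "\<Gamma>; beyond X s i # H \<turnstile> Or (beyond X (Snoc X s x) i) (at2 M (prepend X (Snoc X s x) \<beta> \<cdot> i) i)"
  proof (rule ex_elim[OF hyp[of "beyond X s i", unfolded beyond_def]])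
    let ?H = "Eq TN (tsub wk i) (nplus (len X (tsub wk s)) (Var 0)) # map (fsub wk) (beyond X s i # H)"
    show "TN # \<Gamma>; ?H \<turnstile> fsub wk (Or (beyond X (Snoc X s x) i) (at2 M (prepend X (Snoc X s x) \<beta> \<cdot> i) i))"
      using correct_seq_Snoc_aux[of "wk_at2 M" "tsub wk x" X "tsub wk s" ?H "TN # \<Gamma>" "tsub wk i" "tsub wk \<beta>" "Var 0"]
        assms hyp_wk[OF assms(2)] by simp
  qed (simp add: beyond_def)
  let ?H = "at2 M (prepend X s ?c \<cdot> i) i # H"
  have "\<Gamma>; ?H \<turnstile> at2 M (prepend X (Snoc X s x) \<beta> \<cdot> i) i"
    by (rule at2_cong1[OF deq_sym[OF deq_app1[OF prepend_Snoc]] _ _ hyp]) (use assms in simp_all)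
  then show "\<Gamma>; ?H \<turnstile> Or (beyond X (Snoc X s x) i) (at2 M (prepend X (Snoc X s x) \<beta> \<cdot> i) i)"
    by (rule OrI2) (use assms in simp)
qed

lemma correct_seq_Snoc:
  assumes "\<Gamma>; H \<turnstile> correct_seq X M s" "\<Gamma>; H \<turnstile> at2 M x (len X s)"
    and "wff (X # TN # \<Gamma>) M" "tyof \<Gamma> s = Some (TStar X)" "tyof \<Gamma> x = Some X"
  shows "\<Gamma>; H \<turnstile> correct_seq X M (Snoc X s x)"
proof (rule cut[OF assms(1) cut[OF weaken[OF assms(2)]]])
  let ?H = "at2 M x (len X s) # correct_seq X M s # H"
  show "\<Gamma>; ?H \<turnstile> correct_seq X M (Snoc X s x)"
    using correct_seq_Snoc_inst[of X "wk_at2 (wk_at2 M)" "tsub wk (tsub wk s)" "map (fsub wk) (map (fsub wk) ?H)"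
        "tsub wk (tsub wk x)" "(TN \<rightarrow> X) # TN # \<Gamma>" "Var 1" "Var 0"] assms
    by (intro correct_seq_intro) simp
qed (use assms in auto)

text \<open>A position not beyond s is settled by \<open>correct_seq\<close>; a position |s| + k is
  entry k of the tail by \<open>prepend_len_nplus\<close>.\<close>

lemma correct_seq_full:
  assumes "correct_seq X M s \<in> set H"
    and "Forall TN (at2 (wk_at2 M) (tsub wk \<alpha> \<cdot> Var 0) (nplus (len X (tsub wk s)) (Var 0))) \<in> set H"
    and "wff (X # TN # \<Gamma>) M" "tyof \<Gamma> s = Some (TStar X)" "tyof \<Gamma> \<alpha> = Some (TN \<rightarrow> X)"
    and "tyof \<Gamma> i = Some TN"
  shows "\<Gamma>; H \<turnstile> at2 M (prepend X s \<alpha> \<cdot> i) i"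
proof (rule OrE)
  show "\<Gamma>; H \<turnstile> Or (beyond X s i) (at2 M (prepend X s \<alpha> \<cdot> i) i)"
    using assms by (intro correct_seq_elim hyp)
  show "\<Gamma>; at2 M (prepend X s \<alpha> \<cdot> i) i # H \<turnstile> at2 M (prepend X s \<alpha> \<cdot> i) i"
    by (rule hyp) simp
  show "\<Gamma>; beyond X s i # H \<turnstile> at2 M (prepend X s \<alpha> \<cdot> i) i"
  proof (rule ex_elim[OF hyp[of "beyond X s i", unfolded beyond_def]])
    let ?s = "tsub wk s" and ?i = "tsub wk i" and ?G = "TN # \<Gamma>" and ?\<alpha> = "tsub wk \<alpha>"
    let ?H = "Eq TN ?i (nplus (len X ?s) (Var 0)) # map (fsub wk) (beyond X s i # H)"
    have "?G; ?H \<turnstile> Forall TN (at2 (wk_at2 (wk_at2 M)) (tsub wk ?\<alpha> \<cdot> Var 0) (nplus (len X (tsub wk ?s)) (Var 0)))"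
      using hyp_wk[OF assms(2)] by (intro hyp) simp
    from all_elim[OF this, of "Var 0"]
    have *: "?G; ?H \<turnstile> at2 (wk_at2 M) (?\<alpha> \<cdot> Var 0) (nplus (len X ?s) (Var 0))" by simp
    have i: "deq ?G ?H TN (nplus (len X ?s) (Var 0)) ?i"
      using assms by (intro deq_sym[OF deq_hyp]) simp_all
    have "deq ?G ?H X (?\<alpha> \<cdot> Var 0) (prepend X ?s ?\<alpha> \<cdot> nplus (len X ?s) (Var 0))"
      using assms by (intro deq_sym[OF prepend_len_nplus]) simp_all
    also have "deq ?G ?H X \<dots> (prepend X ?s ?\<alpha> \<cdot> ?i)"
      using assms by (intro deq_app2[OF i]) simp_all
    finally have "?G; ?H \<turnstile> at2 (wk_at2 M) (prepend X ?s ?\<alpha> \<cdot> ?i) ?i"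
      by (rule at2_cong[OF _ i _ *]) (use assms in simp)
    then show "?G; ?H \<turnstile> fsub wk (at2 M (prepend X s \<alpha> \<cdot> i) i)" by simp
  qed (simp add: beyond_def)
qed

section \<open>Bar induction\<close>

text \<open>Brings the sequence of P(s * x) into the form that the equation of \<open>ips\<close>
  gives for P(s), with x in place of the head.\<close>

lemma prepend_ips_Snoc:
  assumes "tyof \<Gamma> s = Some (TStar X)" "tyof \<Gamma> x = Some X" "tyof \<Gamma> \<epsilon> = Some (sel_ty X Y)"
    and "tyof \<Gamma> q = Some ((TN \<rightarrow> X) \<rightarrow> Y)"
  shows "deq \<Gamma> H (TN \<rightarrow> X)
    (prepend X (Snoc X s x) (ips X Y (len X (Snoc X s x)) \<epsilon> (q_after X q (Snoc X s x))))
    (prepend X s (seq_cons X x (ips X Y (Succ (len X s)) \<epsilon> (fun_cons X (q_after X q s) x))))"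
proof -
  have "deq \<Gamma> H (TN \<rightarrow> X)
    (prepend X (Snoc X s x) (ips X Y (len X (Snoc X s x)) \<epsilon> (q_after X q (Snoc X s x))))
    (prepend X (Snoc X s x) (ips X Y (Succ (len X s)) \<epsilon> (fun_cons X (q_after X q s) x)))"
    using assms by (intro deq_prepend deq_ips len_Snoc q_after_Snoc deq_refl) simp_all
  also have "deq \<Gamma> H (TN \<rightarrow> X) \<dots>
    (prepend X s (seq_cons X x (ips X Y (Succ (len X s)) \<epsilon> (fun_cons X (q_after X q s) x))))"
    using assms by (intro prepend_Snoc) simp_all
  finally show ?thesis .
qed

lemma correct_ips_elim:
  assumes "\<Gamma>; H \<turnstile> correct_ips X Y M \<epsilon> q s" "tyof \<Gamma> i = Some TN"
  shows "\<Gamma>; H \<turnstile> at2 M (prepend X s (ips X Y (len X s) \<epsilon> (q_after X q s)) \<cdot> i) i"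
  using all_elim[OF assms(1)[unfolded correct_ips_def] assms(2)] by simp

text \<open>The premise of the induction step in \<open>BI\<close>, in the form in which the
  simplifier presents it.\<close>

definition correct_step :: "ty \<Rightarrow> ty \<Rightarrow> fm \<Rightarrow> trm \<Rightarrow> trm \<Rightarrow> trm \<Rightarrow> fm" where
  "correct_step X Y M \<epsilon> q s = Forall X (Imp (correct_seq X (wk_at2 M) (Snoc X (tsub wk s) (Var 0)))
     (correct_ips X Y (wk_at2 M) (tsub wk \<epsilon>) (tsub wk q) (Snoc X (tsub wk s) (Var 0))))"

lemma fsub_correct_step [simp]:
  "fsub f (correct_step X Y M \<epsilon> q s) = correct_step X Y (fsub (up (up f)) M) (tsub f \<epsilon>) (tsub f q) (tsub f s)"
  by (simp add: correct_step_def)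

text \<open>Serves twice: for a variable x realizing A(|s|), to show that the continuation realizes
  A(|s|) -> R, and then for the head chosen by \<epsilon>.\<close>

lemma correct_step_elim:
  assumes "correct_seq X M s \<in> set H" "correct_step X Y M \<epsilon> q s \<in> set H" "\<Gamma>; H \<turnstile> at2 M x (len X s)"
    and "wff (X # TN # \<Gamma>) M" "tyof \<Gamma> s = Some (TStar X)" "tyof \<Gamma> x = Some X" "tyof \<Gamma> i = Some TN"
    and "tyof \<Gamma> \<epsilon> = Some (sel_ty X Y)" "tyof \<Gamma> q = Some ((TN \<rightarrow> X) \<rightarrow> Y)"
  shows "\<Gamma>; H \<turnstile> at2 M (prepend X s (seq_cons X x
    (ips X Y (Succ (len X s)) \<epsilon> (fun_cons X (q_after X q s) x))) \<cdot> i) i"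
proof -
  have "\<Gamma>; H \<turnstile> correct_seq X M (Snoc X s x)"
    using assms by (intro correct_seq_Snoc[OF hyp]) simp_all
  moreover have "\<Gamma>; H \<turnstile> Imp (correct_seq X M (Snoc X s x)) (correct_ips X Y M \<epsilon> q (Snoc X s x))"
    using all_elim[OF hyp[OF assms(2), unfolded correct_step_def] assms(6)] by simp
  ultimately have "\<Gamma>; H \<turnstile> correct_ips X Y M \<epsilon> q (Snoc X s x)" using ImpE by blast
  from correct_ips_elim[OF this assms(7)] show ?thesis
    by (rule at2_cong1[OF deq_app1[OF prepend_ips_Snoc], rotated -1]) (use assms in simp_all)
qed

lemma correct_ips_step_head:
  assumes "sel_hyp X Y M Q \<epsilon> \<in> set H" "outcome_hyp X M Q q \<in> set H" "correct_seq X M s \<in> set H" "correct_step X Y M \<epsilon> q s \<in> set H"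
    and "wff (X # TN # \<Gamma>) M" "wff (Y # \<Gamma>) Q" "tyof \<Gamma> s = Some (TStar X)"
    and "tyof \<Gamma> \<epsilon> = Some (sel_ty X Y)" "tyof \<Gamma> q = Some ((TN \<rightarrow> X) \<rightarrow> Y)"
  shows "\<Gamma>; H \<turnstile> at2 M (ips_head X Y (len X s) \<epsilon> (q_after X q s)) (len X s)"
  unfolding ips_head_eq
proof (rule sel_hyp_elim[OF hyp[OF assms(1)]])
  let ?G = "X # \<Gamma>" and ?H = "at2 (wk_at2 M) (Var 0) (tsub wk (len X s)) # map (fsub wk) H"
  let ?s = "tsub wk s" and ?\<epsilon> = "tsub wk \<epsilon>" and ?q = "tsub wk q"
  let ?\<beta> = "ips X Y (Succ (len X ?s)) ?\<epsilon> (fun_cons X (q_after X ?q ?s) (Var 0))"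
  \<comment> \<open>The argument at which the continuation evaluates q, once \<open>fun_cons\<close>
    and \<open>q_after\<close> are unfolded.\<close>
  let ?\<alpha> = "prepend X ?s (seq_cons X (Var 0) ?\<beta>)"
  have *: "?G; ?H \<turnstile> at1 (wk_at1 Q) (?q \<cdot> ?\<alpha>)"
  proof (rule outcome_hyp_elim[OF hyp])
    show "outcome_hyp X (wk_at2 M) (wk_at1 Q) ?q \<in> set ?H" using hyp_wk[OF assms(2)] by simp
    let ?G' = "TN # ?G" and ?H' = "map (fsub wk) ?H"
    have "?G'; ?H' \<turnstile> at2 (wk_at2 (wk_at2 M)) (Var 1) (len X (tsub wk ?s))" by (rule hyp) simp
    from correct_step_elim[OF _ _ this, of Y "tsub wk ?\<epsilon>" "tsub wk ?q" "Var 0"]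
    show "?G'; ?H' \<turnstile> at2 (wk_at2 (wk_at2 M)) (tsub wk ?\<alpha> \<cdot> Var 0) (Var 0)"
      using hyp_wk[OF hyp_wk[OF assms(3)]] hyp_wk[OF hyp_wk[OF assms(4)]] assms by simp
  qed (use assms in simp)
  have "deq ?G ?H Y (ips_arg X Y (len X ?s) ?\<epsilon> (q_after X ?q ?s) \<cdot> Var 0)
      (fun_cons X (q_after X ?q ?s) (Var 0) \<cdot> ?\<beta>)"
    using assms by (intro ips_arg_app) simp_all
  also have "deq ?G ?H Y \<dots> (q_after X ?q ?s \<cdot> seq_cons X (Var 0) ?\<beta>)"
    using assms by (intro fun_cons_app) simp_all
  also have "deq ?G ?H Y \<dots> (?q \<cdot> ?\<alpha>)"
    using assms by (intro q_after_app) simp_all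
  finally show "?G; ?H \<turnstile> at1 (wk_at1 Q) (tsub wk (ips_arg X Y (len X s) \<epsilon> (q_after X q s)) \<cdot> Var 0)"
    using at1_cong[OF deq_sym _ *] assms by simp
qed (use assms in simp_all)

lemma correct_ips_step_inst:
  assumes "sel_hyp X Y M Q \<epsilon> \<in> set H" "outcome_hyp X M Q q \<in> set H" "correct_seq X M s \<in> set H" "correct_step X Y M \<epsilon> q s \<in> set H"
    and "wff (X # TN # \<Gamma>) M" "wff (Y # \<Gamma>) Q" "discrete_ty Y" "tyof \<Gamma> s = Some (TStar X)"
    and "tyof \<Gamma> \<epsilon> = Some (sel_ty X Y)" "tyof \<Gamma> q = Some ((TN \<rightarrow> X) \<rightarrow> Y)" "tyof \<Gamma> i = Some TN"
  shows "\<Gamma>; H \<turnstile> at2 M (prepend X s (ips X Y (len X s) \<epsilon> (q_after X q s)) \<cdot> i) i"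
proof -
  let ?c = "ips_head X Y (len X s) \<epsilon> (q_after X q s)"
  let ?\<beta> = "ips X Y (Succ (len X s)) \<epsilon> (fun_cons X (q_after X q s) ?c)"
  have c: "tyof \<Gamma> ?c = Some X" using assms by simp
  have *: "\<Gamma>; H \<turnstile> at2 M (prepend X s (seq_cons X ?c ?\<beta>) \<cdot> i) i"
    by (rule correct_step_elim[OF assms(3,4) correct_ips_step_head[OF assms(1-6)]]) (use assms c in simp_all)
  have "deq \<Gamma> H X (prepend X s (ips X Y (len X s) \<epsilon> (q_after X q s)) \<cdot> i) (prepend X s (seq_cons X ?c ?\<beta>) \<cdot> i)"
    using assms by (intro deq_app1[of _ _ TN] deq_prepend ips_unfold deq_refl) simp_all
  then show ?thesis
    by (rule at2_cong1[OF deq_sym _ _ *]) (use assms in simp_all)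
qed

lemma correct_ips_step:
  assumes "sel_hyp X Y M Q \<epsilon> \<in> set H" "outcome_hyp X M Q q \<in> set H" "correct_seq X M s \<in> set H" "correct_step X Y M \<epsilon> q s \<in> set H"
    and "wff (X # TN # \<Gamma>) M" "wff (Y # \<Gamma>) Q" "discrete_ty Y" "tyof \<Gamma> s = Some (TStar X)"
    and "tyof \<Gamma> \<epsilon> = Some (sel_ty X Y)" "tyof \<Gamma> q = Some ((TN \<rightarrow> X) \<rightarrow> Y)"
  shows "\<Gamma>; H \<turnstile> correct_ips X Y M \<epsilon> q s"
  unfolding correct_ips_def
proof (rule all_intro)
  show "TN # \<Gamma>; map (fsub wk) H
    \<turnstile> at2 (wk_at2 M) (tsub wk (prepend X s (ips X Y (len X s) \<epsilon> (q_after X q s))) \<cdot> Var 0) (Var 0)"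
    using correct_ips_step_inst[of X Y "wk_at2 M" "wk_at1 Q" "tsub wk \<epsilon>" "map (fsub wk) H" "tsub wk q" "tsub wk s"
        "TN # \<Gamma>" "Var 0"] assms(5-) assms(1-4)[THEN hyp_wk] by simp
qed

section \<open>Continuity and the bar\<close>

definition modulus :: "ty \<Rightarrow> ty \<Rightarrow> trm \<Rightarrow> trm \<Rightarrow> trm \<Rightarrow> fm" where
  "modulus X Y q \<alpha> n = Forall (TN \<rightarrow> X) (Imp
     (Eq (TStar X) (tsub wk (initseg X \<alpha> n)) (initseg X (Var 0) (tsub wk n)))
     (Eq Y (tsub wk (q \<cdot> \<alpha>)) (tsub wk q \<cdot> Var 0)))"

lemma fsub_modulus [simp]:
  "fsub f (modulus X Y q \<alpha> n) = modulus X Y (tsub f q) (tsub f \<alpha>) (tsub f n)"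
  by (simp add: modulus_def)

text \<open>\<open>modulus\<close> is the body of \<open>CONT\<close> at fixed q, \<alpha> and n;
  naming it lets it be kept as a hypothesis and lifted as a unit.\<close>

lemma CONT_elim:
  assumes "discrete_ty Y" "tyof \<Gamma> q = Some ((TN \<rightarrow> X) \<rightarrow> Y)" "tyof \<Gamma> \<alpha> = Some (TN \<rightarrow> X)"
  shows "\<Gamma>; H \<turnstile> Exists TN (modulus X Y (tsub wk q) (tsub wk \<alpha>) (Var 0))"
proof -
  have "\<Gamma>; H \<turnstile> CONT X Y" by (intro ax theory_axiom.CONT assms)
  from all_elim[OF all_elim[OF this[unfolded CONT_def] assms(2), simplified] assms(3)]
  show ?thesis by (simp add: modulus_def)
qed

text \<open>The segment s of \<alpha> has length n, so s * \<beta> agrees with \<alpha> up to n for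
  every \<beta>, and the modulus applies.\<close>

lemma modulus_const:
  assumes "modulus X Y q \<alpha> n \<in> set H"
    and "tyof \<Gamma> q = Some ((TN \<rightarrow> X) \<rightarrow> Y)" "tyof \<Gamma> \<alpha> = Some (TN \<rightarrow> X)" "tyof \<Gamma> n = Some TN"
    and "tyof \<Gamma> \<beta> = Some (TN \<rightarrow> X)"
  shows "deq \<Gamma> H Y (q_after X q (initseg X \<alpha> n) \<cdot> \<beta>) (q \<cdot> \<alpha>)"
proof -
  let ?s = "initseg X \<alpha> n"
  let ?\<gamma> = "prepend X ?s \<beta>"
  have \<gamma>: "tyof \<Gamma> ?\<gamma> = Some (TN \<rightarrow> X)" using assms by simp
  have "deq \<Gamma> H (TStar X) ?s (initseg X ?\<gamma> (len X ?s))"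
    using assms by (intro deq_sym[OF initseg_prepend]) simp_all
  also have "deq \<Gamma> H (TStar X) \<dots> (initseg X ?\<gamma> n)"
    using assms by (intro deq_initseg len_initseg) simp_all
  finally have "\<Gamma>; H \<turnstile> Eq (TStar X) ?s (initseg X ?\<gamma> n)" by (rule deq_Eq)
  moreover have "\<Gamma>; H \<turnstile> Imp (Eq (TStar X) ?s (initseg X ?\<gamma> n)) (Eq Y (q \<cdot> \<alpha>) (q \<cdot> ?\<gamma>))"
    using all_elim[OF hyp[OF assms(1), unfolded modulus_def] \<gamma>] by simp
  ultimately have "\<Gamma>; H \<turnstile> Eq Y (q \<cdot> \<alpha>) (q \<cdot> ?\<gamma>)" using ImpE by blast
  then have "deq \<Gamma> H Y (q \<cdot> ?\<gamma>) (q \<cdot> \<alpha>)"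
    using assms by (intro deq_sym[of _ _ _ "q \<cdot> \<alpha>"]) (simp add: deq_def)
  with q_after_app[of \<Gamma> q X Y ?s \<beta> H] show ?thesis
    using assms deq_trans by simp
qed

lemma outcome_all_initseg:
  assumes "outcome_hyp X M Q q \<in> set H" "modulus X Y q \<alpha> n \<in> set H"
    and "Forall TN (correct_seq X (wk_at2 M) (initseg X (tsub wk \<alpha>) (Var 0))) \<in> set H"
    and "wff (X # TN # \<Gamma>) M" "wff (Y # \<Gamma>) Q"
    and "tyof \<Gamma> q = Some ((TN \<rightarrow> X) \<rightarrow> Y)" "tyof \<Gamma> \<alpha> = Some (TN \<rightarrow> X)" "tyof \<Gamma> n = Some TN"
  shows "\<Gamma>; H \<turnstile> outcome_all X Q (q_after X q (initseg X \<alpha> n))"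
  unfolding outcome_all_def
proof (rule all_intro)
  let ?G = "(TN \<rightarrow> X) # \<Gamma>" and ?H = "map (fsub wk) H"
  let ?q = "tsub wk q" and ?\<alpha> = "tsub wk \<alpha>" and ?n = "tsub wk n"
  have *: "?G; ?H \<turnstile> at1 (wk_at1 Q) (?q \<cdot> ?\<alpha>)"
  proof (rule outcome_hyp_elim[OF hyp])
    show "outcome_hyp X (wk_at2 M) (wk_at1 Q) ?q \<in> set ?H" using hyp_wk[OF assms(1)] by simp
    show "TN # ?G; map (fsub wk) ?H \<turnstile> at2 (wk_at2 (wk_at2 M)) (tsub wk ?\<alpha> \<cdot> Var 0) (Var 0)"
      by (rule correct_seq_limit[OF hyp]) (use assms(4-) hyp_wk[OF hyp_wk[OF assms(3)]] in simp_all)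
  qed (use assms in simp)
  have "deq ?G ?H Y (q_after X ?q (initseg X ?\<alpha> ?n) \<cdot> Var 0) (?q \<cdot> ?\<alpha>)"
    using assms(4-) hyp_wk[OF assms(2)] by (intro modulus_const) simp_all
  then show "?G; ?H \<turnstile> at1 (wk_at1 Q) (tsub wk (q_after X q (initseg X \<alpha> n)) \<cdot> Var 0)"
    using at1_cong[OF deq_sym _ *] assms by simp
qed

text \<open>\<open>const_ips\<close> at stage |s| makes entry k of the tail correct for position |s|
  + k, which is what \<open>correct_seq_full\<close> asks of a tail.\<close>

lemma correct_ips_const_inst:
  assumes "sel_hyp X Y M Q \<epsilon> \<in> set H" "outcome_all X Q (q_after X q s) \<in> set H" "correct_seq X M s \<in> set H"
    and "wff (X # TN # \<Gamma>) M" "wff (Y # \<Gamma>) Q" "discrete_ty Y" "tyof \<Gamma> s = Some (TStar X)"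
    and "tyof \<Gamma> \<epsilon> = Some (sel_ty X Y)" "tyof \<Gamma> q = Some ((TN \<rightarrow> X) \<rightarrow> Y)" "tyof \<Gamma> i = Some TN"
  shows "\<Gamma>; H \<turnstile> at2 M (prepend X s (ips X Y (len X s) \<epsilon> (q_after X q s)) \<cdot> i) i"
proof (rule cut)
  let ?\<beta> = "ips X Y (len X s) \<epsilon> (q_after X q s)"
  let ?F = "Forall TN (at2 (wk_at2 M) (tsub wk ?\<beta> \<cdot> Var 0) (nplus (len X (tsub wk s)) (Var 0)))"
  show "\<Gamma>; H \<turnstile> ?F"
    using const_ips[of X Y "wk_at2 M" "wk_at1 Q" "tsub wk \<epsilon>" "map (fsub wk) H" "TN # \<Gamma>" "tsub wk (len X s)"
        "tsub wk (q_after X q s)" "Var 0"] assms(4-) assms(1,2)[THEN hyp_wk]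
    by (intro all_intro) simp
  show "\<Gamma>; ?F # H \<turnstile> at2 M (prepend X s ?\<beta> \<cdot> i) i"
    using assms by (intro correct_seq_full) simp_all
qed (use assms in simp)

lemma correct_ips_const:
  assumes "sel_hyp X Y M Q \<epsilon> \<in> set H" "outcome_all X Q (q_after X q s) \<in> set H" "correct_seq X M s \<in> set H"
    and "wff (X # TN # \<Gamma>) M" "wff (Y # \<Gamma>) Q" "discrete_ty Y" "tyof \<Gamma> s = Some (TStar X)"
    and "tyof \<Gamma> \<epsilon> = Some (sel_ty X Y)" "tyof \<Gamma> q = Some ((TN \<rightarrow> X) \<rightarrow> Y)"
  shows "\<Gamma>; H \<turnstile> correct_ips X Y M \<epsilon> q s"
  unfolding correct_ips_def
proof (rule all_intro)
  show "TN # \<Gamma>; map (fsub wk) H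
    \<turnstile> at2 (wk_at2 M) (tsub wk (prepend X s (ips X Y (len X s) \<epsilon> (q_after X q s))) \<cdot> Var 0) (Var 0)"
    using correct_ips_const_inst[of X Y "wk_at2 M" "wk_at1 Q" "tsub wk \<epsilon>" "map (fsub wk) H" "tsub wk q" "tsub wk s"
        "TN # \<Gamma>" "Var 0"] assms(4-) assms(1-3)[THEN hyp_wk] by simp
qed

lemma correct_ips_bar:
  assumes "sel_hyp X Y M Q \<epsilon> \<in> set H" "outcome_hyp X M Q q \<in> set H"
    and "Forall TN (correct_seq X (wk_at2 M) (initseg X (tsub wk \<alpha>) (Var 0))) \<in> set H"
    and "wff (X # TN # \<Gamma>) M" "wff (Y # \<Gamma>) Q" "discrete_ty Y"
    and "tyof \<Gamma> \<epsilon> = Some (sel_ty X Y)" "tyof \<Gamma> q = Some ((TN \<rightarrow> X) \<rightarrow> Y)" "tyof \<Gamma> \<alpha> = Some (TN \<rightarrow> X)"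
  shows "\<Gamma>; H \<turnstile> Exists TN (correct_ips X Y (wk_at2 M) (tsub wk \<epsilon>) (tsub wk q) (initseg X (tsub wk \<alpha>) (Var 0)))"
proof (rule ex_elim[OF CONT_elim])
  let ?G = "TN # \<Gamma>" and ?M = "wk_at2 M" and ?Q = "wk_at1 Q"
  let ?\<alpha> = "tsub wk \<alpha>" and ?q = "tsub wk q" and ?\<epsilon> = "tsub wk \<epsilon>"
  let ?s = "initseg X ?\<alpha> (Var 0)"
  let ?H = "modulus X Y ?q ?\<alpha> (Var 0) # map (fsub wk) H"
  note hyps = assms(1-3)[THEN hyp_wk]
  have C: "?G; ?H \<turnstile> outcome_all X ?Q (q_after X ?q ?s)"
    by (rule outcome_all_initseg[of _ ?M _ _ _ Y]) (use assms(4-) hyps in simp_all)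
  have S: "?G; ?H \<turnstile> correct_seq X ?M ?s"
  proof -
    have "?G; ?H \<turnstile> Forall TN (correct_seq X (wk_at2 ?M) (initseg X (tsub wk ?\<alpha>) (Var 0)))"
      by (rule hyp) (use hyps in simp)
    from all_elim[OF this, of "Var 0"] show ?thesis by simp
  qed
  have P: "?G; correct_seq X ?M ?s # outcome_all X ?Q (q_after X ?q ?s) # ?H \<turnstile> correct_ips X Y ?M ?\<epsilon> ?q ?s"
    by (rule correct_ips_const[of _ _ _ ?Q]) (use assms(4-) hyps in simp_all)
  have "?G; ?H \<turnstile> correct_ips X Y ?M ?\<epsilon> ?q ?s"
    by (rule cut[OF C cut[OF weaken[OF S] P]]) (use assms(4-) in \<open>auto simp: wff_outcome_all[of _ _ _ Y]\<close>)
  \<comment> \<open>The length at which P holds is the number obtained from continuity.\<close>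
  then have "?G; ?H \<turnstile> Exists TN (correct_ips X Y (wk_at2 ?M) (tsub wk ?\<epsilon>) (tsub wk ?q) (initseg X (tsub wk ?\<alpha>) (Var 0)))"
    using assms(4-) by (intro ex_intro[of _ _ "Var 0"]) simp_all
  then show "?G; ?H \<turnstile> fsub wk (Exists TN (correct_ips X Y ?M ?\<epsilon> ?q ?s))" by simp
qed (use assms in simp_all)

lemma correct_ips_Empty:
  assumes "sel_hyp X Y M Q \<epsilon> \<in> set H" "outcome_hyp X M Q q \<in> set H"
    and "wff (X # TN # \<Gamma>) M" "wff (Y # \<Gamma>) Q" "discrete_ty Y"
    and "tyof \<Gamma> \<epsilon> = Some (sel_ty X Y)" "tyof \<Gamma> q = Some ((TN \<rightarrow> X) \<rightarrow> Y)"
  shows "\<Gamma>; H \<turnstile> correct_ips X Y M \<epsilon> q (Empty X)"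
proof -
  \<comment> \<open>The two predicates for \<open>BI\<close>: \<open>Var 0\<close> is the finite
    sequence, and the parameters are lifted past it.\<close>
  let ?S = "correct_seq X (wk_at2 M) (Var 0)" and ?P = "correct_ips X Y (wk_at2 M) (tsub wk \<epsilon>) (tsub wk q) (Var 0)"
  let ?\<epsilon> = "tsub wk \<epsilon>" and ?q = "tsub wk q" and ?M = "wk_at2 M"
  have "(TN \<rightarrow> X) # \<Gamma>; Forall TN (correct_seq X (wk_at2 ?M) (initseg X (Var 1) (Var 0))) # map (fsub wk) H
      \<turnstile> Exists TN (correct_ips X Y (wk_at2 ?M) (tsub wk ?\<epsilon>) (tsub wk ?q) (initseg X (Var 1) (Var 0)))"
    using correct_ips_bar[of X Y ?M "wk_at1 Q" ?\<epsilon> _ ?q "Var 0" "(TN \<rightarrow> X) # \<Gamma>"] assms(3-) assms(1,2)[THEN hyp_wk]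
    by simp
  then have bar: "\<Gamma>; H \<turnstile> Forall (TN \<rightarrow> X) (Imp
      (Forall TN (correct_seq X (wk_at2 ?M) (initseg X (Var 1) (Var 0))))
      (Exists TN (correct_ips X Y (wk_at2 ?M) (tsub wk ?\<epsilon>) (tsub wk ?q) (initseg X (Var 1) (Var 0)))))"
    by (rule all_intro[OF ImpI]) (use assms in simp)
  have "TStar X # \<Gamma>; correct_step X Y ?M ?\<epsilon> ?q (Var 0) # ?S # map (fsub wk) H \<turnstile> ?P"
    using correct_ips_step[of X Y ?M "wk_at1 Q" ?\<epsilon> _ ?q "Var 0" "TStar X # \<Gamma>"] assms(3-) assms(1,2)[THEN hyp_wk]
    by simp
  then have step: "\<Gamma>; H \<turnstile> Forall (TStar X) (Imp ?S (Imp (correct_step X Y ?M ?\<epsilon> ?q (Var 0)) ?P))"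
    using assms by (intro all_intro ImpI) (simp_all add: correct_step_def)
  have "\<Gamma>; H \<turnstile> BI X ?S ?P"
    using assms by (intro ax theory_axiom.BI) simp_all
  from ImpE[OF ImpE2[OF this[unfolded BI_def, simplified] correct_seq_Empty]] bar step assms
  show ?thesis by (simp add: correct_step_def)
qed

text \<open>At the empty sequence the prefix, the length and \<open>q_after\<close> disappear up to
  provable equality.\<close>

lemma ips_realizes:
  assumes "sel_hyp X Y M Q \<epsilon> \<in> set H" "outcome_hyp X M Q q \<in> set H"
    and "wff (X # TN # \<Gamma>) M" "wff (Y # \<Gamma>) Q" "discrete_ty Y"
    and "tyof \<Gamma> \<epsilon> = Some (sel_ty X Y)" "tyof \<Gamma> q = Some ((TN \<rightarrow> X) \<rightarrow> Y)" "tyof \<Gamma> i = Some TN"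
  shows "\<Gamma>; H \<turnstile> at2 M (ips X Y Zero \<epsilon> q \<cdot> i) i"
proof -
  have "deq \<Gamma> H (TN \<rightarrow> X) (prepend X (Empty X) (ips X Y (len X (Empty X)) \<epsilon> (q_after X q (Empty X))))
      (ips X Y (len X (Empty X)) \<epsilon> (q_after X q (Empty X)))"
    using assms by (intro prepend_Empty) simp
  also have "deq \<Gamma> H (TN \<rightarrow> X) \<dots> (ips X Y Zero \<epsilon> q)"
    using assms by (intro deq_ips len_Empty q_after_Empty)
  finally have "deq \<Gamma> H X (prepend X (Empty X) (ips X Y (len X (Empty X)) \<epsilon> (q_after X q (Empty X))) \<cdot> i)
      (ips X Y Zero \<epsilon> q \<cdot> i)"
    using assms by (intro deq_app1)
  then show ?thesis
    by (rule at2_cong1[OF _ _ _ correct_ips_elim[OF correct_ips_Empty[OF assms(1-7)]]]) (use assms in simp_all)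
qed

text \<open>Such realizers are built from \<open>TB\<close> by products and function types. A
  function type is compact or discrete only if its argument type is of the opposite kind, so both
  properties are proved together.\<close>

lemma qf_rty_compact_discrete: "qf A \<Longrightarrow> compact_ty (rty A) \<and> discrete_ty (rty A)"
  by (induction A) (auto intro: compact_ty_discrete_ty.intros)

text \<open>A realizer pairs a numerical witness with a realizer of the matrix; \<open>TN\<close> is
  discrete, and so is the type of the latter.\<close>

lemma sigma01_discrete:
  assumes "sigma01 R" shows "discrete_ty (rty R)"
proof -
  obtain R0 where "R = Exists TN R0" "qf R0" using assms sigma01_def by auto
  then show ?thesis
    using qf_rty_compact_discrete[of R0] by (simp add: compact_ty_discrete_ty.intros)
qed

section \<open>Modified realizability of the J-shift\<close>

lemma fsub_inst_Var_0 [simp]: "fsub (inst (Var 0)) (fsub (up wk) A) = A"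
proof -
  have "(\<lambda>i. tsub (inst (Var 0)) (up wk i)) = Var"
  proof
    fix i show "tsub (inst (Var 0)) (up wk i) = Var i" by (cases i) simp_all
  qed
  then show ?thesis by (simp add: fsub_fsub)
qed

lemma fsub_inst_Var_Suc [simp]:
  "fsub (inst (Var (Suc n))) (fsub (up wk) A) = fsub wk (fsub (inst (Var n)) A)"
  using fsub_inst[of wk "Var n" A] by simp

text \<open>In \<open>mr (Var 0) (fsub wk A)\<close> variable 0 is the realizer and variable 1 the
  number n of \<open>A\<close>. As \<open>mr\<close> commutes with substitution, filling both slots
  gives back realizability of A(n).\<close>

lemma mr_eq_sel_hyp: "mr t (Forall TN (J (flift 1 R) A)) =
    sel_hyp (rty A) (rty R) (mr (Var 0) (fsub wk A)) (mr (Var 0) (fsub wk R)) t"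
  by (simp add: J_def sel_hyp_def at2_def at1_def)

lemma mr_eq_outcome_hyp: "mr t (Imp (Forall TN A) R) =
    outcome_hyp (rty A) (mr (Var 0) (fsub wk A)) (mr (Var 0) (fsub wk R)) t"
  by (simp add: outcome_hyp_def at2_def at1_def)

lemma mr_ips:
  assumes "mr \<epsilon> (Forall TN (J (flift 1 R) A)) \<in> set H" "mr q (Imp (Forall TN A) R) \<in> set H"
    and "wff (TN # \<Gamma>) A" "wff \<Gamma> R" "discrete_ty (rty R)"
    and "tyof \<Gamma> \<epsilon> = Some (sel_ty (rty A) (rty R))" "tyof \<Gamma> q = Some ((TN \<rightarrow> rty A) \<rightarrow> rty R)"
  shows "\<Gamma>; H \<turnstile> mr (ips (rty A) (rty R) Zero \<epsilon> q) (Forall TN A)"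
proof -
  let ?M = "mr (Var 0) (fsub wk A)" and ?Q = "mr (Var 0) (fsub wk R)"
  let ?H = "map (fsub wk) H" and ?G = "TN # \<Gamma>"
  have "?G; ?H \<turnstile> at2 (wk_at2 ?M) (ips (rty A) (rty R) Zero (tsub wk \<epsilon>) (tsub wk q) \<cdot> Var 0) (Var 0)"
  proof (rule ips_realizes[of _ _ _ "wk_at1 ?Q"])
    show "sel_hyp (rty A) (rty R) (wk_at2 ?M) (wk_at1 ?Q) (tsub wk \<epsilon>) \<in> set ?H"
      using hyp_wk[OF assms(1)[unfolded mr_eq_sel_hyp]] by simp
    show "outcome_hyp (rty A) (wk_at2 ?M) (wk_at1 ?Q) (tsub wk q) \<in> set ?H"
      using hyp_wk[OF assms(2)[unfolded mr_eq_outcome_hyp]] by simp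
    show "wff (rty A # TN # ?G) (wk_at2 ?M)" "wff (rty R # ?G) (wk_at1 ?Q)"
      using assms by (auto intro!: wff_up_up_wk wff_up_wk wff_mr wff_fsub[OF typed_sub_wk])
  qed (use assms in simp_all)
  then have "\<Gamma>; H \<turnstile> Forall TN (mr (ips (rty A) (rty R) Zero (tsub wk \<epsilon>) (tsub wk q) \<cdot> Var 0) A)"
    by (intro all_intro) (simp add: at2_def)
  then show ?thesis by simp
qed

theorem theorem4p3:
  fixes \<Gamma> :: "ty list" and A R :: fm
  assumes "HA_formula (TN # \<Gamma>) A"
    and "HA_formula \<Gamma> R"
    and "sigma01 R"
  shows "\<Gamma>; [] \<turnstile> mr (Con (CIps (rty A) (rty R)) \<cdot> Con CZero) (J_shift R A)"
proof -
  let ?X = "rty A" and ?Y = "rty R"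
  \<comment> \<open>Each implication of the shift quantifies over a realizer: \<open>?A1\<close> and
    \<open>?R1\<close> are lifted past \<epsilon>, \<open>?A2\<close> and \<open>?R2\<close> also
    past q, with n staying variable 0 of \<open>A\<close>.\<close>
  let ?A1 = "fsub (up wk) A" and ?R1 = "fsub wk R"
  let ?A2 = "fsub (up wk) ?A1" and ?R2 = "fsub wk ?R1"
  let ?\<epsilon> = "mr (Var 0) (Forall TN (J (flift 1 ?R1) ?A1))"
  let ?q = "mr (Var 0) (Imp (Forall TN ?A2) ?R2)"
  let ?goal = "mr (ips ?X ?Y Zero (Var 1) (Var 0)) (Forall TN ?A2)"
  let ?G1 = "sel_ty ?X ?Y # \<Gamma>"
  let ?G2 = "((TN \<rightarrow> ?X) \<rightarrow> ?Y) # ?G1"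
  have wff: "wff (TN # \<Gamma>) A" "wff \<Gamma> R" using assms by (simp_all add: HA_formula_def)
  then have wff1: "wff (TN # ?G1) ?A1" "wff ?G1 ?R1" by (simp_all add: wff_fsub[OF typed_sub_wk])
  then have wff2: "wff (TN # ?G2) ?A2" "wff ?G2 ?R2" by (simp_all add: wff_fsub[OF typed_sub_wk])
  have "?G2; ?q # map (fsub wk) [?\<epsilon>] \<turnstile> ?goal"
    using mr_ips[of "Var 1" ?R2 ?A2 _ "Var 0" ?G2] wff2 sigma01_discrete[OF assms(3)]
    by (simp add: J_def)
  moreover have "wff ?G2 ?q"
    using wff2 by (intro wff_mr) simp_all
  moreover have "wff ?G1 ?\<epsilon>"
    using wff1 by (intro wff_mr) (simp_all add: J_def wff_fsub[OF typed_sub_wk])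
  \<comment> \<open>\<open>mr.simps\<close> is removed so that \<open>?\<epsilon>\<close>,
    \<open>?q\<close> and \<open>?goal\<close> keep the form of the three collected facts; unfolding
    the shift is left to the last step.\<close>
  ultimately have "\<Gamma>; [] \<turnstile> Forall (sel_ty ?X ?Y) (Imp ?\<epsilon> (Forall ((TN \<rightarrow> ?X) \<rightarrow> ?Y) (Imp ?q ?goal)))"
    by (auto intro!: all_intro ImpI simp del: mr.simps)
  then show ?thesis by (simp add: J_shift_def J_def ips_def)
qed

end
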